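(* Let $C,D\in\mathbb{C}[\![x,y]\!]$ be power series whose degree 1 homogeneous parts $C_1,D_1$ satisfy $C_{1,x}+D_{1,y}\neq 0$, and let $d\ge 18$. Let $A=\sum_{k\ge d}A_k$ and $B=\sum_{k\ge d}B_k$ be formal power series, with $A_k,B_k$ homogeneous of degree $k$, obtained by choosing, successively for $k=d,d+1,d+2,\dots$, a general element $(A_k,B_k)$ of the affine space of solutions of $$A_{k,y}-B_{k,x}=\sum_{i=0}^{k-1-d}C_iA_{k-1-i}+\sum_{i=0}^{k-1-d}D_iB_{k-1-i}$$ (for $k=d$ the right hand side is $0$). Then there is no $\Phi\in\mathbb{C}[\![x,y]\!]$ satisfying the equality of ideals $$(\Phi_x,\Phi_y)=(A,B)\subset\mathbb{C}[\![x,y]\!].$$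
   Context: Notation: a power series is written as the sum of its homogeneous parts, $C=C_0+C_1+C_2+\cdots$ and $D=D_0+D_1+D_2+\cdots$, with $C_i,D_i$ homogeneous polynomials of degree $i$ in $x,y$. Subscripts $x,y$ denote partial derivatives, e.g. $A_{k,y}=\partial A_k/\partial y$ and $C_{1,x}=\partial C_1/\partial x$. The displayed equations for all $k\ge d$ are together equivalent to $A_y-B_x=CA+DB$ in $\mathbb{C}[\![x,y]\!]$, i.e. they give an equation guaranteeing that the formal 1-form $A\,dx+B\,dy$ is almost closed ($A_y-B_x\in(A,B)$). For given $A_d,\dots,A_{k-1},B_d,\dots,B_{k-1}$, the solutions $(A_k,B_k)$ of the $k$-th equation among pairs of homogeneous polynomials of degree $k$ form a nonempty finite-dimensional affine space over $\mathbb{C}$. "General" means: at each stage $k$ there is a proper Zariski closed subset of this affine space (which may depend on $d$, $C$, $D$ and the previously chosen $A_j,B_j$, $j<k$) such that the conclusion holds whenever, at every stage, the chosen $(A_k,B_k)$ lies outside that subset. *)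

theory Defs
  imports "HOL-Computational_Algebra.Formal_Power_Series" "HOL-Library.FuncSet"
begin

unbundle fps_syntax

text \<open>
  The ring of formal power series in \<open>x, y\<close> is represented as \<open>\<complex>[[x]][[y]]\<close>:
  the coefficient of \<open>x^i y^j\<close> in \<open>f\<close> is \<open>f $ j $ i\<close>,
  so \<open>y\<close> is \<open>fps_X\<close> and \<open>x\<close> is \<open>fps_const fps_X\<close>.
\<close>

type_synonym cps2 = "complex fps fps"

definition dx :: "cps2 \<Rightarrow> cps2" where
  "dx f = Abs_fps (\<lambda>j. fps_deriv (f $ j))"

definition dy :: "cps2 \<Rightarrow> cps2" where
  "dy f = fps_deriv f"

definition hom_part :: "nat \<Rightarrow> cps2 \<Rightarrow> cps2" where
  "hom_part k f = Abs_fps (\<lambda>j. Abs_fps (\<lambda>i. if i + j = k then f $ j $ i else 0))"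

definition homogeneous :: "nat \<Rightarrow> cps2 \<Rightarrow> bool" where
  "homogeneous k f \<longleftrightarrow> (\<forall>i j. f $ j $ i \<noteq> 0 \<longrightarrow> i + j = k)"

lemma dx_nth: "dx f $ j $ i = of_nat (Suc i) * f $ j $ Suc i"
  by (simp add: dx_def)

lemma dy_nth: "dy f $ j $ i = of_nat (Suc j) * f $ Suc j $ i"
  unfolding dy_def fps_deriv_nth fps_of_nat[symmetric] Suc_eq_plus1
  by (simp only: fps_mult_left_const_nth)

lemma hom_part_nth: "hom_part k f $ j $ i = (if i + j = k then f $ j $ i else 0)"
  by (simp add: hom_part_def)

lemma homogeneous_iff_hom_part: "homogeneous k f \<longleftrightarrow> hom_part k f = f"
  by (auto simp: homogeneous_def fps_eq_iff hom_part_nth)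

lemma homogeneous_hom_part: "homogeneous k (hom_part k f)"
  by (simp add: homogeneous_def hom_part_nth)

text \<open>An ideal of a commutative ring is a submodule of the ring as a module over itself.\<close>

abbreviation ideal_gen :: "'a::comm_ring_1 set \<Rightarrow> 'a set" where
  "ideal_gen \<equiv> module.span (*)"

lemma module_mult: "module ((*) :: 'a::comm_ring_1 \<Rightarrow> 'a \<Rightarrow> 'a)"
  by unfold_locales (auto simp: algebra_simps)

lemma ideal_gen_pair:
  fixes f g :: "'a::comm_ring_1"
  shows "ideal_gen {f, g} = {a * f + b * g | a b. True}"
proof -
  interpret module "(*) :: 'a \<Rightarrow> 'a \<Rightarrow> 'a" by (rule module_mult)
  show ?thesis
    by (auto simp: span_insert span_singleton algebra_simps)
qed

text \<open>
  The solutions \<open>(P, Q)\<close> of the \<open>k\<close>-th equation, where \<open>h j\<close> is the pair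
  \<open>(A_j, B_j)\<close> chosen at stage \<open>j\<close>; only the values of \<open>h\<close> on
  \<open>{d..<k}\<close> matter. The range \<open>i < k - d\<close> is
  \<open>0 \<le> i \<le> k - 1 - d\<close>, empty for \<open>k = d\<close>.
\<close>

definition solutions ::
  "cps2 \<Rightarrow> cps2 \<Rightarrow> nat \<Rightarrow> nat \<Rightarrow> (nat \<Rightarrow> cps2 \<times> cps2) \<Rightarrow> (cps2 \<times> cps2) set" where
  "solutions C D d k h =
     {(P, Q). homogeneous k P \<and> homogeneous k Q \<and>
        dy P - dx Q = (\<Sum>i<k - d. hom_part i C * fst (h (k - 1 - i)))
                    + (\<Sum>i<k - d. hom_part i D * snd (h (k - 1 - i)))}"

text \<open>
  Polynomial functions in the coefficients of a pair of power series. On pairs of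
  homogeneous polynomials of a fixed degree, all but finitely many coefficients vanish,
  and these are the polynomial functions on a finite-dimensional vector space.
\<close>

inductive polynomial_fun :: "(cps2 \<times> cps2 \<Rightarrow> complex) \<Rightarrow> bool" where
  const: "polynomial_fun (\<lambda>_. c)"
| coeff_fst: "polynomial_fun (\<lambda>p. fst p $ j $ i)"
| coeff_snd: "polynomial_fun (\<lambda>p. snd p $ j $ i)"
| add: "polynomial_fun f \<Longrightarrow> polynomial_fun g \<Longrightarrow> polynomial_fun (\<lambda>p. f p + g p)"
| mult: "polynomial_fun f \<Longrightarrow> polynomial_fun g \<Longrightarrow> polynomial_fun (\<lambda>p. f p * g p)"

definition zariski_closed_in :: "(cps2 \<times> cps2) set \<Rightarrow> (cps2 \<times> cps2) set \<Rightarrow> bool" where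
  "zariski_closed_in S Z \<longleftrightarrow>
     (\<exists>F. (\<forall>f\<in>F. polynomial_fun f) \<and> Z = {p \<in> S. \<forall>f\<in>F. f p = 0})"

definition parts :: "cps2 \<Rightarrow> cps2 \<Rightarrow> nat \<Rightarrow> cps2 \<times> cps2" where
  "parts A B k = (hom_part k A, hom_part k B)"

text \<open>
  A choice of a proper Zariski closed subset \<open>Z k h\<close> of the solution space at every
  stage \<open>k \<ge> d\<close>, where \<open>h\<close> is the history of the earlier choices.
  Passing \<open>restrict h {d..<k}\<close> to \<open>Z k\<close> makes the subset depend on
  nothing but these.
\<close>

definition exceptional_family ::
  "cps2 \<Rightarrow> cps2 \<Rightarrow> nat \<Rightarrow> (nat \<Rightarrow> (nat \<Rightarrow> cps2 \<times> cps2) \<Rightarrow> (cps2 \<times> cps2) set) \<Rightarrow> bool" where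
  "exceptional_family C D d Z \<longleftrightarrow>
     (\<forall>k\<ge>d. \<forall>h. (\<forall>j\<in>{d..<k}. h j \<in> solutions C D d j h) \<longrightarrow>
        zariski_closed_in (solutions C D d k h) (Z k (restrict h {d..<k})) \<and>
        Z k (restrict h {d..<k}) \<noteq> solutions C D d k h)"

definition chosen_outside ::
  "cps2 \<Rightarrow> cps2 \<Rightarrow> nat \<Rightarrow> (nat \<Rightarrow> (nat \<Rightarrow> cps2 \<times> cps2) \<Rightarrow> (cps2 \<times> cps2) set)
     \<Rightarrow> cps2 \<Rightarrow> cps2 \<Rightarrow> bool" where
  "chosen_outside C D d Z A B \<longleftrightarrow>
     (\<forall>k<d. hom_part k A = 0 \<and> hom_part k B = 0) \<and>
     (\<forall>k\<ge>d. parts A B k \<in> solutions C D d k (parts A B)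
                             - Z k (restrict (parts A B) {d..<k}))"

end

theory Submission
  imports Defs "Jordan_Normal_Form.Determinant"
begin

text \<open>
  Write \<open>\<Phi>_x = X A + Y B\<close> and \<open>\<Phi>_y = Z A + W B\<close>. Equality of the mixed derivatives of
  \<open>\<Phi>\<close>, together with \<open>A_y - B_x = C A + D B\<close>, becomes the syzygy
  \<open>a A + b B + e B_x + Y B_y - Z A_x = 0\<close> with \<open>a = X_y - Z_x + X C\<close>,
  \<open>b = Y_y - W_x + X D\<close> and \<open>e = X - W\<close>. Suppose that in degree \<open>d + 2\<close> the twelve cubic
  multiples of the second derivatives \<open>A_{d,x}, A_{d,y} = B_{d,x}, B_{d,y}\<close> and the four forms
  \<open>x A_{d+1}, y A_{d+1}, x B_{d+1}, y B_{d+1}\<close> are linearly independent; this is the only genericity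
  used. The lowest degree of the syzygy then forces it to be a multiple of Euler's relations
  for \<open>A_d, B_d\<close>, with coefficients the leading parts of \<open>a, b\<close>. In the next degree the same
  Euler relations, applied to \<open>A_{d+1}, B_{d+1}\<close> of degree one higher, no longer cancel and leave
  \<open>a A_{d+1} + b B_{d+1}\<close>, so these leading parts vanish. Doing this twice shows that
  \<open>a, b\<close> vanish to order 2 and \<open>e, Y, Z\<close> to order 3. Hence up to order 2 one has
  \<open>X_y = - X C\<close> and \<open>X_x = X D\<close> with \<open>X(0) \<noteq> 0\<close>, and comparing \<open>X_{xy}\<close> at the origin gives
  \<open>C_{1,x} + D_{1,y} = 0\<close>.
\<close>

no_notation vec_index (infixl "$" 100)

section \<open>Derivatives, homogeneous parts and Euler's identity\<close>

abbreviation varx :: cps2 where "varx \<equiv> fps_const fps_X"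
abbreviation vary :: cps2 where "vary \<equiv> fps_X"
abbreviation scalar :: "complex \<Rightarrow> cps2" where "scalar c \<equiv> fps_const (fps_const c)"

lemma cps2_eq_iff: "(f :: cps2) = g \<longleftrightarrow> (\<forall>i j. f $ j $ i = g $ j $ i)"
  by (auto simp: fps_eq_iff)

lemma cps2_mult_nth:
  "((f :: cps2) * g) $ j $ i = (\<Sum>m\<le>j. \<Sum>l\<le>i. f $ m $ l * g $ (j - m) $ (i - l))"
  by (simp add: fps_mult_nth fps_sum_nth atMost_atLeast0)

lemma dx_add [simp]: "dx (f + g) = dx f + dx g"
  and dx_diff [simp]: "dx (f - g) = dx f - dx g"
  and dx_mult [simp]: "dx (f * g) = dx f * g + f * dx g"
  and dx_varx [simp]: "dx varx = 1"
  and dx_vary [simp]: "dx vary = 0"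
  and dx_scalar [simp]: "dx (scalar c) = 0"
  unfolding dx_def
  by (simp_all add: fps_eq_iff[where 'a = "complex fps"] fps_mult_nth fps_deriv_sum sum.distrib
      add.commute)

lemma dy_add [simp]: "dy (f + g) = dy f + dy g"
  and dy_diff [simp]: "dy (f - g) = dy f - dy g"
  and dy_mult [simp]: "dy (f * g) = dy f * g + f * dy g"
  and dy_varx [simp]: "dy varx = 0"
  and dy_vary [simp]: "dy vary = 1"
  and dy_scalar [simp]: "dy (scalar c) = 0"
  by (simp_all add: dy_def)

lemma dy_dx: "dy (dx f) = dx (dy f)"
  by (simp add: cps2_eq_iff dx_nth dy_nth)

lemma hom_part_add: "hom_part k (f + g) = hom_part k f + hom_part k g"
  and hom_part_diff: "hom_part k (f - g) = hom_part k f - hom_part k g"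
  and hom_part_0: "hom_part k 0 = 0"
  and hom_part_dx: "hom_part k (dx f) = dx (hom_part (Suc k) f)"
  and hom_part_dy: "hom_part k (dy f) = dy (hom_part (Suc k) f)"
  by (simp_all add: cps2_eq_iff hom_part_nth dx_nth dy_nth)

lemma homogeneous_add: "homogeneous k f \<Longrightarrow> homogeneous k g \<Longrightarrow> homogeneous k (f + g)"
  and homogeneous_diff: "homogeneous k f \<Longrightarrow> homogeneous k g \<Longrightarrow> homogeneous k (f - g)"
  and homogeneous_0: "homogeneous k 0"
  by (simp_all add: homogeneous_iff_hom_part hom_part_add hom_part_diff hom_part_0)

lemma homogeneous_scalar: "homogeneous 0 (scalar c)"
  and homogeneous_varx: "homogeneous 1 varx"
  and homogeneous_vary: "homogeneous 1 vary"
  by (auto simp: homogeneous_def fps_X_def split: if_splits)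

lemma homogeneous_sum: "(\<And>i. i \<in> I \<Longrightarrow> homogeneous k (f i)) \<Longrightarrow> homogeneous k (\<Sum>i\<in>I. f i)"
  by (induction I rule: infinite_finite_induct) (auto simp: homogeneous_add homogeneous_0)

lemma homogeneous_mult:
  assumes "homogeneous m f" "homogeneous n g"
  shows "homogeneous (m + n) (f * g)"
  unfolding homogeneous_def
proof (intro allI impI)
  fix i j assume "(f * g) $ j $ i \<noteq> 0"
  then obtain r where r: "r \<le> j" "(\<Sum>l\<le>i. f $ r $ l * g $ (j - r) $ (i - l)) \<noteq> 0"
    unfolding cps2_mult_nth by (meson atMost_iff sum.not_neutral_contains_not_neutral)
  then obtain l where l: "l \<le> i" "f $ r $ l * g $ (j - r) $ (i - l) \<noteq> 0"
    by (meson atMost_iff sum.not_neutral_contains_not_neutral)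
  then have "l + r = m" "(i - l) + (j - r) = n"
    using assms by (auto simp: homogeneous_def)
  with r l show "i + j = m + n" by linarith
qed

lemma homogeneous_power: "homogeneous m f \<Longrightarrow> homogeneous (k * m) (f ^ k)"
  using homogeneous_scalar[of 1] by (induction k) (auto simp: homogeneous_mult)

lemma homogeneous_dx: "homogeneous (Suc k) f \<Longrightarrow> homogeneous k (dx f)"
  and homogeneous_dy: "homogeneous (Suc k) f \<Longrightarrow> homogeneous k (dy f)"
  by (fastforce simp: homogeneous_def dx_nth dy_nth)+

lemma euler:
  assumes "homogeneous k f"
  shows "varx * dx f + vary * dy f = of_nat k * f"
proof -
  have "(varx * dx f + vary * dy f) $ j $ i = (of_nat k * f) $ j $ i" for i j
  proof -
    have "(varx * dx f) $ j $ i = of_nat i * f $ j $ i"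
      by (cases i) (simp_all add: dx_nth)
    moreover have "(vary * dy f) $ j $ i = of_nat j * f $ j $ i"
      by (cases j) (simp_all add: dy_nth)
    moreover have "(of_nat k * f) $ j $ i = of_nat k * f $ j $ i"
      by (simp add: fps_of_nat[symmetric])
    moreover have "of_nat (i + j) * f $ j $ i = of_nat k * f $ j $ i"
      using assms by (cases "f $ j $ i = 0") (auto simp: homogeneous_def)
    ultimately show ?thesis
      by (simp add: algebra_simps)
  qed
  then show ?thesis
    by (simp add: cps2_eq_iff)
qed

lemma hom_part_mult:
  "hom_part k (f * g) = (\<Sum>l\<le>k. hom_part l f * hom_part (k - l) g)"
proof -
  have "hom_part k (f * g) $ j $ i = (\<Sum>l\<le>k. hom_part l f * hom_part (k - l) g) $ j $ i" for i j
  proof (cases "i + j = k")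
    case True
    have "(\<Sum>n\<le>k. hom_part n f * hom_part (k - n) g) $ j $ i =
        (\<Sum>m\<le>j. \<Sum>l\<le>i. \<Sum>n\<le>k. hom_part n f $ m $ l * hom_part (k - n) g $ (j - m) $ (i - l))"
      unfolding fps_sum_nth cps2_mult_nth
      by (subst sum.swap, rule sum.cong[OF refl], rule sum.swap)
    also have "\<dots> = (\<Sum>m\<le>j. \<Sum>l\<le>i. f $ m $ l * g $ (j - m) $ (i - l))"
    proof (intro sum.cong refl)
      fix m l assume "m \<in> {..j}" "l \<in> {..i}"
      \<comment> \<open>The first factor has degree \<open>l + m\<close>, so a single
        \<open>n\<close> survives; \<open>i + j = k\<close> then puts the second factor into degree
        \<open>k - n\<close>.\<close>
      then have "(\<Sum>n\<le>k. hom_part n f $ m $ l * hom_part (k - n) g $ (j - m) $ (i - l))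
          = (\<Sum>n\<le>k. if n = l + m then f $ m $ l * g $ (j - m) $ (i - l) else 0)"
        using True by (intro sum.cong refl) (auto simp: hom_part_nth)
      then show "(\<Sum>n\<le>k. hom_part n f $ m $ l * hom_part (k - n) g $ (j - m) $ (i - l))
          = f $ m $ l * g $ (j - m) $ (i - l)"
        using \<open>m \<in> {..j}\<close> \<open>l \<in> {..i}\<close> True by simp
    qed
    finally show ?thesis
      using True by (simp add: hom_part_nth cps2_mult_nth)
  next
    case False
    have "homogeneous k (\<Sum>l\<le>k. hom_part l f * hom_part (k - l) g)"
    proof (rule homogeneous_sum)
      fix l assume "l \<in> {..k}"
      then show "homogeneous k (hom_part l f * hom_part (k - l) g)"
        using homogeneous_mult[OF homogeneous_hom_part[of l f] homogeneous_hom_part[of "k - l" g]]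
        by simp
    qed
    with False show ?thesis
      by (auto simp: homogeneous_def hom_part_nth)
  qed
  then show ?thesis
    by (simp add: cps2_eq_iff)
qed

lemma cps2_eqI_hom_part: "(\<And>k. hom_part k f = hom_part k g) \<Longrightarrow> f = g"
  by (metis cps2_eq_iff hom_part_nth)

section \<open>Polynomial functions and determinants\<close>

lemma polynomial_fun_sum:
  "(\<And>i. i \<in> I \<Longrightarrow> polynomial_fun (f i)) \<Longrightarrow> polynomial_fun (\<lambda>p. \<Sum>i\<in>I. f i p)"
  by (induction I rule: infinite_finite_induct) (auto intro: polynomial_fun.intros)

lemma polynomial_fun_prod:
  "(\<And>i. i \<in> I \<Longrightarrow> polynomial_fun (f i)) \<Longrightarrow> polynomial_fun (\<lambda>p. \<Prod>i\<in>I. f i p)"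
  by (induction I rule: infinite_finite_induct) (auto intro: polynomial_fun.intros)

text \<open>The polynomial is the determinant of the \<open>n\<close> by \<open>n\<close> matrix:
  Leibniz's formula makes it polynomial in the coefficients, and it vanishes exactly when there is a
  nonzero kernel vector.\<close>

lemma singular_polynomial:
  fixes M :: "nat \<Rightarrow> nat \<Rightarrow> cps2 \<times> cps2 \<Rightarrow> complex" and n :: nat
  assumes "\<And>i j. polynomial_fun (M i j)"
  obtains P where "polynomial_fun P"
    "\<And>p. P p = 0 \<longleftrightarrow>
      (\<exists>v. (\<exists>j<n. v j \<noteq> 0) \<and> (\<forall>i<n. (\<Sum>j<n. M i j p * v j) = 0))"
proof
  define A where "A p = mat n n (\<lambda>(i, j). M i j p)" for p
  have A: "A p \<in> carrier_mat n n" for p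
    by (simp add: A_def)
  have "A p $$ (i, \<pi> i) = M i (\<pi> i) p" if "\<pi> permutes {0..<n}" "i \<in> {0..<n}" for p \<pi> i
    using permutes_in_image[OF that(1), of i] that(2) by (simp add: A_def)
  then have "det (A p) = (\<Sum>\<pi> | \<pi> permutes {0..<n}. signof \<pi> * (\<Prod>i = 0..<n. M i (\<pi> i) p))" for p
    unfolding det_def'[OF A] by simp
  then show "polynomial_fun (\<lambda>p. det (A p))"
    using assms
    by (auto intro!: polynomial_fun_sum polynomial_fun_prod polynomial_fun.const polynomial_fun.mult)
  show "det (A p) = 0 \<longleftrightarrow>
      (\<exists>v. (\<exists>j<n. v j \<noteq> 0) \<and> (\<forall>i<n. (\<Sum>j<n. M i j p * v j) = 0))" (is "_ \<longleftrightarrow> ?r") for p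
    unfolding det_0_iff_vec_prod_zero[OF A]
  proof
    assume "\<exists>v. v \<in> carrier_vec n \<and> v \<noteq> 0\<^sub>v n \<and> A p *\<^sub>v v = 0\<^sub>v n"
    then obtain v where v: "v \<in> carrier_vec n" "v \<noteq> 0\<^sub>v n" "A p *\<^sub>v v = 0\<^sub>v n"
      by blast
    have "\<exists>j<n. vec_index v j \<noteq> 0"
      using v(1,2) by (metis carrier_vecD dim_vec eq_vecI index_zero_vec(1) index_zero_vec(2))
    moreover have "(\<Sum>j<n. M i j p * vec_index v j) = 0" if "i < n" for i
    proof -
      have "vec_index (A p *\<^sub>v v) i = (\<Sum>j<n. M i j p * vec_index v j)"
        using that v(1) by (simp add: A_def scalar_prod_def atLeast0LessThan)
      then show ?thesis
        using v(3) that by simp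
    qed
    ultimately show ?r
      by blast
  next
    assume ?r
    then obtain v where v: "\<exists>j<n. v j \<noteq> 0" "\<forall>i<n. (\<Sum>j<n. M i j p * v j) = 0"
      by blast
    have "vec n v \<noteq> 0\<^sub>v n"
      using v(1) by (metis index_vec index_zero_vec(1))
    moreover have "A p *\<^sub>v vec n v = 0\<^sub>v n"
      using v(2) by (intro eq_vecI) (simp_all add: A_def scalar_prod_def atLeast0LessThan)
    ultimately show "\<exists>v. v \<in> carrier_vec n \<and> v \<noteq> 0\<^sub>v n \<and> A p *\<^sub>v v = 0\<^sub>v n"
      by (metis vec_carrier)
  qed
qed

section \<open>The genericity condition\<close>

definition polynomial_series :: "(cps2 \<times> cps2 \<Rightarrow> cps2) \<Rightarrow> bool" where
  "polynomial_series F \<longleftrightarrow> (\<forall>i j. polynomial_fun (\<lambda>p. F p $ j $ i))"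

lemma polynomial_series_intros:
  shows polynomial_series_const: "polynomial_series (\<lambda>_. c)"
    and polynomial_series_fst: "polynomial_series fst"
    and polynomial_series_snd: "polynomial_series snd"
    and polynomial_series_mult: "polynomial_series F \<Longrightarrow> polynomial_series G \<Longrightarrow>
      polynomial_series (\<lambda>p. F p * G p)"
    and polynomial_series_dx: "polynomial_series F \<Longrightarrow> polynomial_series (\<lambda>p. dx (F p))"
    and polynomial_series_dy: "polynomial_series F \<Longrightarrow> polynomial_series (\<lambda>p. dy (F p))"
  unfolding polynomial_series_def cps2_mult_nth dx_nth dy_nth
  by (auto intro!: polynomial_fun_sum intro: polynomial_fun.intros)

definition monomial :: "complex \<Rightarrow> nat \<Rightarrow> nat \<Rightarrow> cps2" where
  "monomial c m n = fps_const (fps_const c * fps_X ^ m) * vary ^ n"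

lemma monomial_nth: "monomial c m n $ j $ i = (if i = m \<and> j = n then c else 0)"
  by (simp add: monomial_def fps_X_power_iff)

lemma monomial_mult: "monomial c m n * monomial c' m' n' = monomial (c * c') (m + m') (n + n')"
proof -
  have "monomial c m n * monomial c' m' n' =
      fps_const ((fps_const c * fps_X ^ m) * (fps_const c' * fps_X ^ m')) * (vary ^ n * vary ^ n')"
    unfolding monomial_def by (simp add: mult_ac)
  also have "(fps_const c * fps_X ^ m) * (fps_const c' * fps_X ^ m') =
      fps_const (c * c') * fps_X ^ (m + m')"
    by (simp add: power_add mult_ac flip: fps_const_mult)
  finally show ?thesis
    by (simp add: monomial_def power_add)
qed

lemma scalar_eq_monomial: "scalar c = monomial c 0 0"
  and varx_eq_monomial: "varx = monomial 1 1 0"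
  and vary_eq_monomial: "vary = monomial 1 0 1"
  by (simp_all add: monomial_def)

lemma homogeneous_monomial: "m + n = k \<Longrightarrow> homogeneous k (monomial c m n)"
  by (auto simp add: homogeneous_def monomial_nth)

lemma monomial_0 [simp]: "monomial 0 m n = 0"
  by (simp add: monomial_def)

definition cubics :: "cps2 list" where
  "cubics = [monomial 1 3 0, monomial 1 2 1, monomial 1 1 2, monomial 1 0 3]"

text \<open>
  For \<open>(P, Q) = (dx f, dy f)\<close> the first three blocks are the multiples of the second
  derivatives of \<open>f\<close>.
\<close>

definition columns :: "cps2 \<times> cps2 \<Rightarrow> cps2 \<times> cps2 \<Rightarrow> cps2 list" where
  "columns p q =
     map (\<lambda>m. m * dx (fst p)) cubics @ map (\<lambda>m. m * dy (fst p)) cubics @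
     map (\<lambda>m. m * dy (snd p)) cubics @
     [varx * fst q, vary * fst q, varx * snd q, vary * snd q]"

text \<open>
  The pair \<open>(i, j)\<close> stands for the monomial \<open>x^i y^j\<close>. These sixteen monomials are the
  pivots of the columns for the explicit pair of forms used as witness below.
\<close>

definition positions :: "nat \<Rightarrow> (nat \<times> nat) list" where
  "positions d =
     [(d + 2, 0), (d + 1, 1), (d, 2), (d - 1, 3),
      (8, d - 6), (7, d - 5), (6, d - 4), (5, d - 3),
      (3, d - 1), (2, d), (1, d + 1), (0, d + 2),
      (10, d - 8), (11, d - 9), (12, d - 10), (13, d - 11)]"

text \<open>
  Independence of the columns is required already on the sixteen monomials above, so that it is the
  nonvanishing of a single determinant.
\<close>

definition transversal :: "nat \<Rightarrow> cps2 \<times> cps2 \<Rightarrow> cps2 \<times> cps2 \<Rightarrow> bool" where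
  "transversal d p q \<longleftrightarrow>
     (\<forall>v. (\<forall>(i, j) \<in> set (positions d). (\<Sum>n<16. scalar (v n) * columns p q ! n) $ j $ i = 0)
        \<longrightarrow> (\<forall>n<16. v n = 0))"

lemma sum_lessThan_16:
  fixes h :: "nat \<Rightarrow> 'a::comm_monoid_add"
  shows "(\<Sum>n<16. h n) = h 0 + h 1 + h 2 + h 3 + h 4 + h 5 + h 6 + h 7 + h 8 + h 9 + h 10 + h 11 +
    h 12 + h 13 + h 14 + h 15"
  by (simp add: eval_nat_numeral add_ac)

lemma all_less_16:
  "(\<forall>n<16. R n) \<longleftrightarrow> R 0 \<and> R 1 \<and> R 2 \<and> R 3 \<and> R 4 \<and> R 5 \<and> R 6 \<and> R 7 \<and> R 8 \<and> R 9 \<and> R 10 \<and>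
    R 11 \<and> R 12 \<and> R 13 \<and> R 14 \<and> R (15::nat)"
  by (simp add: eval_nat_numeral All_less_Suc conj_ac)

text \<open>Collecting the sixteen coefficients into three cubic and two linear forms is the passage
  from coefficient vectors to syzygies.\<close>

lemma columns_sum:
  "(\<Sum>n<16. scalar (v n) * columns p q ! n) =
     (monomial (v 0) 3 0 + monomial (v 1) 2 1 + monomial (v 2) 1 2 + monomial (v 3) 0 3) * dx (fst p) +
     (monomial (v 4) 3 0 + monomial (v 5) 2 1 + monomial (v 6) 1 2 + monomial (v 7) 0 3) * dy (fst p) +
     (monomial (v 8) 3 0 + monomial (v 9) 2 1 + monomial (v 10) 1 2 + monomial (v 11) 0 3) * dy (snd p) +
     (monomial (v 12) 1 0 + monomial (v 13) 0 1) * fst q +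
     (monomial (v 14) 1 0 + monomial (v 15) 0 1) * snd q"
  unfolding sum_lessThan_16 columns_def cubics_def scalar_eq_monomial varx_eq_monomial vary_eq_monomial
  by (simp add: monomial_mult distrib_right flip: mult.assoc numeral_2_eq_2)

lemma length_positions: "length (positions d) = 16"
  by (simp add: positions_def)

text \<open>Sixteen columns read at sixteen monomials form a square matrix, and transversality says
  that its kernel is trivial. The maps \<open>F\<close> and \<open>G\<close> leave open which of the
  two pairs varies.\<close>

lemma transversal_polynomial_general:
  assumes "\<And>n. n < 16 \<Longrightarrow> polynomial_series (\<lambda>p. columns (F p) (G p) ! n)"
  obtains P where "polynomial_fun P" "\<And>p. P p \<noteq> 0 \<longleftrightarrow> transversal d (F p) (G p)"
proof -
  \<comment> \<open>For \<open>j \<ge> 16\<close> the column list has ended; the default 0 makes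
    every entry polynomial.\<close>
  define M where "M i j p = (if j < 16
      then columns (F p) (G p) ! j $ snd (positions d ! i) $ fst (positions d ! i) else 0)" for i j p
  have "polynomial_fun (M i j)" for i j
    using assms[of j] unfolding M_def polynomial_series_def
    by (cases "j < 16") (auto intro: polynomial_fun.const)
  then obtain P where P: "polynomial_fun P"
    "\<And>p. P p = 0 \<longleftrightarrow> (\<exists>v. (\<exists>j<16. v j \<noteq> 0) \<and> (\<forall>i<16. (\<Sum>j<16. M i j p * v j) = 0))"
    using singular_polynomial by blast
  have "(\<Sum>j<16. M i j p * v j) =
    (\<Sum>n<16. scalar (v n) * columns (F p) (G p) ! n) $ snd (positions d ! i) $ fst (positions d ! i)"
    for i p v
    unfolding M_def by (simp add: fps_sum_nth mult.commute)
  then have "P p \<noteq> 0 \<longleftrightarrow> transversal d (F p) (G p)" for p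
    unfolding P(2) transversal_def
    by (auto simp: all_set_conv_all_nth length_positions case_prod_beta)
  with P(1) show thesis
    using that by blast
qed

lemma polynomial_series_columns:
  assumes "n < 16"
  shows "polynomial_series (\<lambda>p. columns p q ! n)" "polynomial_series (\<lambda>q. columns p q ! n)"
proof -
  have "\<forall>n<16. polynomial_series (\<lambda>p. columns p q ! n) \<and> polynomial_series (\<lambda>q. columns p q ! n)"
    unfolding all_less_16 columns_def cubics_def
    by (simp add: polynomial_series_intros)
  with assms show "polynomial_series (\<lambda>p. columns p q ! n)" "polynomial_series (\<lambda>q. columns p q ! n)"
    by blast+
qed

text \<open>Serves stage \<open>d\<close>, where the first pair varies against a fixed second one;
  its companion serves stage \<open>d + 1\<close>, where the first pair has been chosen
  already.\<close>

lemma transversal_polynomial_fst: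
  obtains P where "polynomial_fun P" "\<And>p. P p \<noteq> 0 \<longleftrightarrow> transversal d p q"
  by (rule transversal_polynomial_general[of "\<lambda>p. p" "\<lambda>_. q" d])
    (auto intro: polynomial_series_columns)

lemma transversal_polynomial_snd:
  obtains P where "polynomial_fun P" "\<And>q. P q \<noteq> 0 \<longleftrightarrow> transversal d p q"
  by (rule transversal_polynomial_general[of "\<lambda>_. p" "\<lambda>q. q" d])
    (auto intro: polynomial_series_columns)

section \<open>Transversality in terms of forms\<close>

lemma homogeneous_1_eq:
  assumes "homogeneous 1 a"
  shows "a = monomial (a $ 0 $ 1) 1 0 + monomial (a $ 1 $ 0) 0 1"
proof -
  have "a $ j $ i = (monomial (a $ 0 $ 1) 1 0 + monomial (a $ 1 $ 0) 0 1) $ j $ i" for i j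
  proof (cases "i + j = 1")
    case True
    then consider "i = 0" "j = 1" | "i = 1" "j = 0"
      by linarith
    then show ?thesis
      by cases (auto simp: monomial_nth)
  qed (use assms in \<open>auto simp: homogeneous_def monomial_nth\<close>)
  then show ?thesis
    unfolding cps2_eq_iff by blast
qed

lemma homogeneous_3_eq:
  assumes "homogeneous 3 a"
  shows "a = monomial (a $ 0 $ 3) 3 0 + monomial (a $ 1 $ 2) 2 1 + monomial (a $ 2 $ 1) 1 2 +
    monomial (a $ 3 $ 0) 0 3"
proof -
  have "a $ j $ i = (monomial (a $ 0 $ 3) 3 0 + monomial (a $ 1 $ 2) 2 1 + monomial (a $ 2 $ 1) 1 2 +
      monomial (a $ 3 $ 0) 0 3) $ j $ i" for i j
  proof (cases "i + j = 3")
    case True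
    then consider "i = 0" "j = 3" | "i = 1" "j = 2" | "i = 2" "j = 1" | "i = 3" "j = 0"
      by linarith
    then show ?thesis
      by cases (auto simp: monomial_nth)
  qed (use assms in \<open>auto simp: homogeneous_def monomial_nth\<close>)
  then show ?thesis
    unfolding cps2_eq_iff by blast
qed

text \<open>A cubic has four coefficients and a linear form two, so the five forms amount to one
  vector \<open>v\<close> of length sixteen. Vanishing is asked at the pivot monomials, which is the
  version needed to transfer transversality from one pair to another.\<close>

lemma transversalD_positions:
  assumes "transversal d p q"
    and "homogeneous 3 \<alpha>" "homogeneous 3 \<beta>" "homogeneous 3 \<gamma>" "homogeneous 1 a" "homogeneous 1 b"
    and "\<forall>(i, j) \<in> set (positions d).
      (\<alpha> * dx (fst p) + \<beta> * dy (fst p) + \<gamma> * dy (snd p) + a * fst q + b * snd q) $ j $ i = 0"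
  shows "\<alpha> = 0" "\<beta> = 0" "\<gamma> = 0" "a = 0" "b = 0"
proof -
  define v where "v n = [\<alpha> $ 0 $ 3, \<alpha> $ 1 $ 2, \<alpha> $ 2 $ 1, \<alpha> $ 3 $ 0,
     \<beta> $ 0 $ 3, \<beta> $ 1 $ 2, \<beta> $ 2 $ 1, \<beta> $ 3 $ 0, \<gamma> $ 0 $ 3, \<gamma> $ 1 $ 2, \<gamma> $ 2 $ 1, \<gamma> $ 3 $ 0,
     a $ 0 $ 1, a $ 1 $ 0, b $ 0 $ 1, b $ 1 $ 0] ! n" for n
  have v: "v 0 = \<alpha> $ 0 $ 3" "v 1 = \<alpha> $ 1 $ 2" "v 2 = \<alpha> $ 2 $ 1" "v 3 = \<alpha> $ 3 $ 0"
    "v 4 = \<beta> $ 0 $ 3" "v 5 = \<beta> $ 1 $ 2" "v 6 = \<beta> $ 2 $ 1" "v 7 = \<beta> $ 3 $ 0"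
    "v 8 = \<gamma> $ 0 $ 3" "v 9 = \<gamma> $ 1 $ 2" "v 10 = \<gamma> $ 2 $ 1" "v 11 = \<gamma> $ 3 $ 0"
    "v 12 = a $ 0 $ 1" "v 13 = a $ 1 $ 0" "v 14 = b $ 0 $ 1" "v 15 = b $ 1 $ 0"
    by (simp_all add: v_def)
  have eqs:
    "\<alpha> = monomial (v 0) 3 0 + monomial (v 1) 2 1 + monomial (v 2) 1 2 + monomial (v 3) 0 3"
    "\<beta> = monomial (v 4) 3 0 + monomial (v 5) 2 1 + monomial (v 6) 1 2 + monomial (v 7) 0 3"
    "\<gamma> = monomial (v 8) 3 0 + monomial (v 9) 2 1 + monomial (v 10) 1 2 + monomial (v 11) 0 3"
    "a = monomial (v 12) 1 0 + monomial (v 13) 0 1"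
    "b = monomial (v 14) 1 0 + monomial (v 15) 0 1"
    unfolding v by (rule homogeneous_3_eq[OF assms(2)] homogeneous_3_eq[OF assms(3)]
        homogeneous_3_eq[OF assms(4)] homogeneous_1_eq[OF assms(5)] homogeneous_1_eq[OF assms(6)])+
  have "\<forall>(i, j) \<in> set (positions d). (\<Sum>n<16. scalar (v n) * columns p q ! n) $ j $ i = 0"
    unfolding columns_sum eqs[symmetric] by (rule assms(7))
  then have "\<forall>n<16. v n = 0"
    using assms(1) unfolding transversal_def by blast
  then show "\<alpha> = 0" "\<beta> = 0" "\<gamma> = 0" "a = 0" "b = 0"
    by (simp_all add: eqs)
qed

lemma transversalD:
  assumes "transversal d p q"
    and "homogeneous 3 \<alpha>" "homogeneous 3 \<beta>" "homogeneous 3 \<gamma>" "homogeneous 1 a" "homogeneous 1 b"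
    and "\<alpha> * dx (fst p) + \<beta> * dy (fst p) + \<gamma> * dy (snd p) + a * fst q + b * snd q = 0"
  shows "\<alpha> = 0" "\<beta> = 0" "\<gamma> = 0" "a = 0" "b = 0"
proof -
  have "\<forall>(i, j) \<in> set (positions d).
      (\<alpha> * dx (fst p) + \<beta> * dy (fst p) + \<gamma> * dy (snd p) + a * fst q + b * snd q) $ j $ i = 0"
    unfolding assms(7) by auto
  from transversalD_positions[OF assms(1-6) this] show "\<alpha> = 0" "\<beta> = 0" "\<gamma> = 0" "a = 0" "b = 0" .
qed

lemma cubic_coeffs_eq_0:
  assumes "monomial c0 3 0 + monomial c1 2 1 + monomial c2 1 2 + monomial c3 0 3 = 0"
  shows "c0 = 0" "c1 = 0" "c2 = 0" "c3 = 0"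
  using arg_cong[OF assms, of "\<lambda>f. f $ 0 $ 3"] arg_cong[OF assms, of "\<lambda>f. f $ 1 $ 2"]
    arg_cong[OF assms, of "\<lambda>f. f $ 2 $ 1"] arg_cong[OF assms, of "\<lambda>f. f $ 3 $ 0"]
  by (simp_all add: monomial_nth)

lemma linear_coeffs_eq_0:
  assumes "monomial c0 1 0 + monomial c1 0 1 = 0"
  shows "c0 = 0" "c1 = 0"
  using arg_cong[OF assms, of "\<lambda>f. f $ 0 $ 1"] arg_cong[OF assms, of "\<lambda>f. f $ 1 $ 0"]
  by (simp_all add: monomial_nth)

lemma transversalI:
  assumes "\<And>\<alpha> \<beta> \<gamma> a b. homogeneous 3 \<alpha> \<Longrightarrow> homogeneous 3 \<beta> \<Longrightarrow> homogeneous 3 \<gamma> \<Longrightarrow>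
      homogeneous 1 a \<Longrightarrow> homogeneous 1 b \<Longrightarrow>
      \<forall>(i, j) \<in> set (positions d).
        (\<alpha> * dx (fst p) + \<beta> * dy (fst p) + \<gamma> * dy (snd p) + a * fst q + b * snd q) $ j $ i = 0 \<Longrightarrow>
      \<alpha> = 0 \<and> \<beta> = 0 \<and> \<gamma> = 0 \<and> a = 0 \<and> b = 0"
  shows "transversal d p q"
  unfolding transversal_def columns_sum
proof (rule allI, rule impI)
  fix v :: "nat \<Rightarrow> complex"
  have hom3: "homogeneous 3 (monomial c0 3 0 + monomial c1 2 1 + monomial c2 1 2 + monomial c3 0 3)"
    for c0 c1 c2 c3
    by (intro homogeneous_add homogeneous_monomial) simp_all
  have hom1: "homogeneous 1 (monomial c0 1 0 + monomial c1 0 1)" for c0 c1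
    by (intro homogeneous_add homogeneous_monomial) simp_all
  assume "\<forall>(i, j) \<in> set (positions d).
    ((monomial (v 0) 3 0 + monomial (v 1) 2 1 + monomial (v 2) 1 2 + monomial (v 3) 0 3) * dx (fst p) +
     (monomial (v 4) 3 0 + monomial (v 5) 2 1 + monomial (v 6) 1 2 + monomial (v 7) 0 3) * dy (fst p) +
     (monomial (v 8) 3 0 + monomial (v 9) 2 1 + monomial (v 10) 1 2 + monomial (v 11) 0 3) * dy (snd p) +
     (monomial (v 12) 1 0 + monomial (v 13) 0 1) * fst q +
     (monomial (v 14) 1 0 + monomial (v 15) 0 1) * snd q) $ j $ i = 0"
  from assms[OF hom3 hom3 hom3 hom1 hom1 this] show "\<forall>n<16. v n = 0"
    unfolding all_less_16 by (blast dest: cubic_coeffs_eq_0 linear_coeffs_eq_0)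
qed

section \<open>An explicit transversal pair\<close>

text \<open>The witness at stage \<open>d\<close> is the gradient of this form \<open>f\<close>. The
  cubic multiples of the leading terms of \<open>f_xx\<close>, \<open>f_xy\<close>,
  \<open>f_yy\<close>, namely \<open>x^(d-1)\<close>, \<open>x^5 y^(d-6)\<close>,
  \<open>y^(d-1)\<close> up to constants, have x-exponents from \<open>d - 1\<close> to
  \<open>d + 2\<close>, from 5 to 8 and from 0 to 3.\<close>

definition witness_form :: "nat \<Rightarrow> cps2" where
  "witness_form d = monomial 1 (d + 1) 0 + monomial 1 0 (d + 1) + monomial 1 6 (d - 5)"

text \<open>The linear multiples of the first derivatives of this form \<open>g\<close> have
  x-exponents 10 to 13. For \<open>d \<ge> 15\<close> these are avoided by all cubic multiples of
  the second derivatives of \<open>witness_form d\<close>.\<close>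

definition witness_next :: "nat \<Rightarrow> cps2" where
  "witness_next d = monomial 1 11 (d - 9) + monomial 1 12 (d - 10)"

lemma monomial_mult_nth:
  "(monomial c m n * f) $ j $ i = (if m \<le> i \<and> n \<le> j then c * f $ (j - n) $ (i - m) else 0)"
proof -
  have "monomial c m n * f = fps_const (fps_const c * fps_X ^ m) * (vary ^ n * f)"
    by (simp add: monomial_def mult.assoc)
  then show ?thesis
    by (auto simp: mult.assoc fps_X_power_mult_nth)
qed

lemma transversal_witness:
  assumes "d \<ge> 15"
  shows "transversal d (dx (witness_form d), dy (witness_form d))
    (dx (witness_next d), dy (witness_next d))"
  unfolding transversal_def
proof (intro allI impI)
  fix v :: "nat \<Rightarrow> complex" and m
  \<comment> \<open>This substitution removes truncated subtraction, so that exponents can be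
    compared by simplification.\<close>
  obtain n where n: "d = n + 15"
    using le_Suc_ex[OF assms] by (auto simp: add.commute)
  define S where "S = (\<Sum>n<16. scalar (v n) *
    columns (dx (witness_form d), dy (witness_form d)) (dx (witness_next d), dy (witness_next d)) ! n)"
  assume "\<forall>(i, j) \<in> set (positions d). (\<Sum>n<16. scalar (v n) *
    columns (dx (witness_form d), dy (witness_form d)) (dx (witness_next d), dy (witness_next d)) ! n) $ j $ i = 0"
  then have S: "\<forall>(i, j) \<in> set (positions d). S $ j $ i = 0"
    unfolding S_def .
  note S_nth = S_def columns_sum distrib_right fps_add_nth fst_conv snd_conv monomial_mult_nth dx_nth dy_nth
    witness_form_def witness_next_def monomial_nth n
  have nz: "numeral k + (of_nat n :: complex) \<noteq> 0" for k
    by (metis add_is_0 of_nat_add of_nat_eq_0_iff of_nat_numeral zero_neq_numeral)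
  have E: "S $ (0) $ (17+n) = 0" "S $ (1) $ (16+n) = 0" "S $ (2) $ (15+n) = 0" "S $ (3) $ (14+n) = 0" "S $ (9+n) $ (8) = 0" "S $ (10+n) $ (7) = 0" "S $ (11+n) $ (6) = 0" "S $ (12+n) $ (5) = 0" "S $ (14+n) $ (3) = 0" "S $ (15+n) $ (2) = 0" "S $ (16+n) $ (1) = 0" "S $ (17+n) $ (0) = 0" "S $ (7+n) $ (10) = 0" "S $ (6+n) $ (11) = 0" "S $ (5+n) $ (12) = 0" "S $ (4+n) $ (13) = 0"
    using S by (simp_all add: positions_def n add.commute)
  \<comment> \<open>Elimination by blocks. The pivots of \<open>f_xx\<close> (x-exponent at least
    14) and of \<open>f_yy\<close> (at most 3) meet no other column; those of \<open>f_xy\<close>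
    also receive the remaining terms of these two blocks and therefore come third.\<close>
  have v0: "v 0 = 0" "v 1 = 0" "v 2 = 0" "v 3 = 0"
    using E(1-4) nz unfolding S_nth by simp_all
  have v1: "v 8 = 0" "v 9 = 0" "v 10 = 0" "v 11 = 0"
    using E(9-12) nz v0 unfolding S_nth by simp_all
  \<comment> \<open>This is the pivot coefficient \<open>6 (d - 5)\<close> of \<open>f_xy\<close> in
    simplified form.\<close>
  have "60 + of_nat n * 6 = 6 * (10 + (of_nat n :: complex))"
    by simp
  then have "60 + of_nat n * 6 \<noteq> (0 :: complex)"
    by (metis mult_eq_0_iff nz zero_neq_numeral)
  then have v2: "v 4 = 0" "v 5 = 0" "v 6 = 0" "v 7 = 0"
    using E(5-8) v0 v1 unfolding S_nth by simp_all
  have v3: "v 13 = 0" "v 14 = 0"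
    using E(13,16) nz unfolding S_nth by simp_all
  \<comment> \<open>The columns \<open>x g_x\<close> and \<open>y g_y\<close> share their two
    monomials; the determinant of this 2 by 2 block is \<open>-(d + 2)\<close>.\<close>
  have e: "11 * v 12 + (6 + of_nat n) * v 15 = 0" "12 * v 12 + (5 + of_nat n) * v 15 = 0"
    using E(14,15) v3 unfolding S_nth by (simp_all add: algebra_simps)
  have "(17 + of_nat n) * v 15 = 12 * (11 * v 12 + (6 + of_nat n) * v 15)
      - 11 * (12 * v 12 + (5 + of_nat n) * v 15)"
    by (simp add: algebra_simps)
  then have v4: "v 15 = 0"
    using e nz by simp
  then have v5: "v 12 = 0"
    using e by simp
  show "v m = 0" if "m < 16"
    using v0 v1 v2 v3 v4 v5 that all_less_16[of "\<lambda>m. v m = 0"] by simp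
qed

section \<open>Syzygies of generic leading forms\<close>

lemma of_nat_eq_scalar: "(of_nat n :: cps2) = scalar (of_nat n)"
  by (simp add: fps_of_nat)

lemma homogeneous_of_nat: "homogeneous 0 (of_nat n)"
  unfolding of_nat_eq_scalar by (rule homogeneous_scalar)

lemma homogeneous_uminus: "homogeneous k f \<Longrightarrow> homogeneous k (- f)"
  using homogeneous_diff[OF homogeneous_0] by (metis diff_0)

lemma hom_part_0_eq: "hom_part 0 f = scalar (f $ 0 $ 0)"
  by (auto simp: cps2_eq_iff hom_part_nth scalar_eq_monomial monomial_nth)

lemma hom_part_mult_shift:
  assumes "\<And>k. k < e \<Longrightarrow> hom_part k f = 0"
  shows "hom_part (e + m) (u * f) = (\<Sum>i\<le>m. hom_part i u * hom_part (e + m - i) f)"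
proof -
  have "hom_part (e + m) (u * f) = (\<Sum>i\<le>e + m. hom_part i u * hom_part (e + m - i) f)"
    by (rule hom_part_mult)
  also have "\<dots> = (\<Sum>i\<le>m. hom_part i u * hom_part (e + m - i) f)"
    using assms by (intro sum.mono_neutral_right) auto
  finally show ?thesis .
qed

text \<open>Models the two lowest parts of \<open>(A, B)\<close>, with \<open>s\<close> and
  \<open>t\<close> the constant terms of \<open>C\<close> and \<open>D\<close>;
  \<open>closed\<close> and \<open>next_eq\<close> are the equations of stages \<open>d\<close> and
  \<open>d + 1\<close>.\<close>

locale leading_pair =
  fixes d :: nat and P Q P' Q' :: cps2 and s t :: complex
  assumes transversal: "transversal d (P, Q) (P', Q')"
    and d_pos: "d > 0"
    and hom: "homogeneous d P" "homogeneous d Q" "homogeneous (Suc d) P'" "homogeneous (Suc d) Q'"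
    and closed: "dy P = dx Q"
    and next_eq: "dy P' - dx Q' = scalar s * P + scalar t * Q"
begin

lemma euler_P: "of_nat d * P = varx * dx P + vary * dy P"
  and euler_Q: "of_nat d * Q = varx * dy P + vary * dy Q"
  and euler_P': "(1 + of_nat d) * P' = varx * dx P' + vary * dy P'"
  and euler_Q': "(1 + of_nat d) * Q' = varx * dx Q' + vary * dy Q'"
  using euler[OF hom(1)] euler[OF hom(2)] euler[OF hom(3)] euler[OF hom(4)] closed by simp_all

lemma of_nat_d_neq_0: "(of_nat d :: cps2) \<noteq> 0"
  using d_pos by simp

text \<open>Multiplied by \<open>d\<close> and rewritten with Euler's identities for
  \<open>P\<close> and \<open>Q\<close>, the relation combines \<open>P_x\<close>,
  \<open>P_y = Q_x\<close> and \<open>Q_y\<close>, so independence kills its coefficients. The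
  result says that \<open>d\<close> times the relation is \<open>u\<close> times Euler's relation
  for \<open>P\<close> plus \<open>v\<close> times that for \<open>Q\<close>.\<close>

lemma syzygy_leading:
  assumes "m \<le> 2" "homogeneous m u" "homogeneous m v"
    and hom': "homogeneous (Suc m) e" "homogeneous (Suc m) Y" "homogeneous (Suc m) Z"
    and eq: "u * P + v * Q + e * dx Q + Y * dy Q - Z * dx P = 0"
  shows "of_nat d * Z = varx * u" "of_nat d * Y = - (vary * v)"
    "of_nat d * e = - (vary * u + varx * v)"
proof -
  \<comment> \<open>The power of x lifts coefficients of degree \<open>m + 1\<close> to cubics, the
    degree in which independence is assumed.\<close>
  let ?\<delta> = "of_nat d :: cps2" and ?t = "varx ^ (2 - m)"
  have lift: "homogeneous 3 (?t * w)" if "homogeneous (Suc m) w" for w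
    using homogeneous_mult[OF homogeneous_power[OF homogeneous_varx, of "2 - m"] that] assms(1)
    by simp
  have mult: "homogeneous (Suc m) (varx * w)" "homogeneous (Suc m) (vary * w)" if "homogeneous m w" for w
    using homogeneous_mult[OF homogeneous_varx that] homogeneous_mult[OF homogeneous_vary that]
    by simp_all
  have scale: "homogeneous (Suc m) (?\<delta> * w)" if "homogeneous (Suc m) w" for w
    using homogeneous_mult[OF homogeneous_of_nat that] by simp
  have "(varx * u - ?\<delta> * Z) * dx P + (vary * u + varx * v + ?\<delta> * e) * dy P +
      (vary * v + ?\<delta> * Y) * dy Q =
      u * (varx * dx P + vary * dy P) + v * (varx * dy P + vary * dy Q) +
      ?\<delta> * (e * dx Q + Y * dy Q - Z * dx P)"
    unfolding closed by (simp add: algebra_simps)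
  also have "\<dots> = ?\<delta> * (u * P + v * Q + e * dx Q + Y * dy Q - Z * dx P)"
    unfolding euler_P[symmetric] euler_Q[symmetric] by (simp add: algebra_simps)
  also have "\<dots> = 0"
    unfolding eq by simp
  finally have "?t * ((varx * u - ?\<delta> * Z) * dx P + (vary * u + varx * v + ?\<delta> * e) * dy P +
      (vary * v + ?\<delta> * Y) * dy Q) = 0"
    by simp
  then have "?t * (varx * u - ?\<delta> * Z) * dx (fst (P, Q)) +
      ?t * (vary * u + varx * v + ?\<delta> * e) * dy (fst (P, Q)) +
      ?t * (vary * v + ?\<delta> * Y) * dy (snd (P, Q)) + 0 * fst (P', Q') + 0 * snd (P', Q') = 0"
    by (simp add: algebra_simps)
  moreover have "homogeneous 3 (?t * (varx * u - ?\<delta> * Z))"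
    "homogeneous 3 (?t * (vary * u + varx * v + ?\<delta> * e))"
    "homogeneous 3 (?t * (vary * v + ?\<delta> * Y))"
    by (intro lift mult scale homogeneous_add homogeneous_diff assms(2,3) hom')+
  ultimately have "?t * (varx * u - ?\<delta> * Z) = 0" "?t * (vary * u + varx * v + ?\<delta> * e) = 0"
    "?t * (vary * v + ?\<delta> * Y) = 0"
    using transversalD(1-3)[OF transversal _ _ _ homogeneous_0 homogeneous_0] by blast+
  then show "of_nat d * Z = varx * u" "of_nat d * Y = - (vary * v)"
    "of_nat d * e = - (vary * u + varx * v)"
    by (simp_all add: eq_neg_iff_add_eq_0 add_ac del: minus_add_distrib)
qed

text \<open>Euler's factor for \<open>P'\<close> and \<open>Q'\<close> is \<open>d + 1\<close>
  instead of \<open>d\<close>, so inserting the relations leaves \<open>-(u P' + v Q')\<close>, up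
  to a multiple of \<open>P'_y - Q'_x\<close>, which lies in \<open>(P, Q)\<close>. Everything else
  is a combination of second derivatives, and independence forces \<open>u = v = 0\<close>.\<close>

lemma syzygy_next:
  assumes "m \<le> 1" "homogeneous m u" "homogeneous m v"
    and eqs: "of_nat d * Z = varx * u" "of_nat d * Y = - (vary * v)"
      "of_nat d * e = - (vary * u + varx * v)"
    and hom': "homogeneous (Suc m) u'" "homogeneous (Suc m) v'"
      "homogeneous (Suc (Suc m)) e'" "homogeneous (Suc (Suc m)) Y'" "homogeneous (Suc (Suc m)) Z'"
    and eq: "u * P' + v * Q' + e * dx Q' + Y * dy Q' - Z * dx P' +
      (u' * P + v' * Q + e' * dx Q + Y' * dy Q - Z' * dx P) = 0"
  shows "u = 0" "v = 0"
proof -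
  let ?\<delta> = "of_nat d :: cps2" and ?t = "varx ^ (1 - m)"
  \<comment> \<open>\<open>U\<close> and \<open>V\<close> are the total coefficients of
    \<open>P\<close> and \<open>Q\<close> after multiplication by \<open>d\<close>.\<close>
  define U where "U = scalar s * (vary * u) + ?\<delta> * u'"
  define V where "V = scalar t * (vary * u) + ?\<delta> * v'"
  have lift: "homogeneous 3 (?t * w)" if "homogeneous (Suc (Suc m)) w" for w
    using homogeneous_mult[OF homogeneous_power[OF homogeneous_varx, of "1 - m"] that] assms(1)
    by (simp add: numeral_3_eq_3)
  have lift1: "homogeneous 1 (?t * w)" if "homogeneous m w" for w
    using homogeneous_mult[OF homogeneous_power[OF homogeneous_varx, of "1 - m"] that] assms(1)
    by simp
  have mult: "homogeneous (Suc k) (varx * w)" "homogeneous (Suc k) (vary * w)" if "homogeneous k w" for w k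
    using homogeneous_mult[OF homogeneous_varx that] homogeneous_mult[OF homogeneous_vary that]
    by simp_all
  have scale: "homogeneous k (?\<delta> * w)" "homogeneous k (scalar c * w)" if "homogeneous k w" for w k c
    using homogeneous_mult[OF homogeneous_of_nat that] homogeneous_mult[OF homogeneous_scalar that]
    by simp_all
  have UV: "homogeneous (Suc m) U" "homogeneous (Suc m) V"
    unfolding U_def V_def using assms(2) hom' by (auto intro!: homogeneous_add mult scale)
  have "?\<delta> * (u * P' + v * Q' + e * dx Q' + Y * dy Q' - Z * dx P') =
      ?\<delta> * (u * P' + v * Q') + (?\<delta> * e) * dx Q' + (?\<delta> * Y) * dy Q' - (?\<delta> * Z) * dx P'"
    by (simp add: algebra_simps)
  also have "\<dots> = ?\<delta> * (u * P' + v * Q') - u * (varx * dx P' + vary * dy P') -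
      v * (varx * dx Q' + vary * dy Q') + vary * u * (dy P' - dx Q')"
    unfolding eqs by (simp add: algebra_simps)
  also have "\<dots> = - (u * P' + v * Q') + vary * u * (scalar s * P + scalar t * Q)"
    unfolding euler_P'[symmetric] euler_Q'[symmetric] next_eq by (simp add: algebra_simps)
  finally have first: "?\<delta> * (u * P' + v * Q' + e * dx Q' + Y * dy Q' - Z * dx P') =
      - (u * P' + v * Q') + vary * u * (scalar s * P + scalar t * Q)" .
  \<comment> \<open>A second factor \<open>d\<close> lets Euler's identity be applied to
    \<open>U P + V Q\<close>, hence the double \<open>?\<delta>\<close>.\<close>
  have "(varx * U - ?\<delta> * (?\<delta> * Z')) * dx P + (vary * U + varx * V + ?\<delta> * (?\<delta> * e')) * dy P +
      (vary * V + ?\<delta> * (?\<delta> * Y')) * dy Q + (- (?\<delta> * u)) * P' + (- (?\<delta> * v)) * Q' =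
      U * (varx * dx P + vary * dy P) + V * (varx * dy P + vary * dy Q) - ?\<delta> * (u * P' + v * Q') +
      ?\<delta> * (?\<delta> * (e' * dx Q + Y' * dy Q - Z' * dx P))"
    unfolding closed by (simp add: algebra_simps)
  also have "\<dots> = ?\<delta> * (- (u * P' + v * Q') + vary * u * (scalar s * P + scalar t * Q)) +
      ?\<delta> * (?\<delta> * (u' * P + v' * Q + e' * dx Q + Y' * dy Q - Z' * dx P))"
    unfolding euler_P[symmetric] euler_Q[symmetric] U_def V_def by (simp add: algebra_simps)
  also have "\<dots> = ?\<delta> * (?\<delta> * (u * P' + v * Q' + e * dx Q' + Y * dy Q' - Z * dx P' +
      (u' * P + v' * Q + e' * dx Q + Y' * dy Q - Z' * dx P)))"
    unfolding first[symmetric] by (simp only: distrib_left)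
  also have "\<dots> = 0"
    unfolding eq by simp
  finally have "?t * ((varx * U - ?\<delta> * (?\<delta> * Z')) * dx P + (vary * U + varx * V + ?\<delta> * (?\<delta> * e')) * dy P +
      (vary * V + ?\<delta> * (?\<delta> * Y')) * dy Q + (- (?\<delta> * u)) * P' + (- (?\<delta> * v)) * Q') = 0"
    by simp
  then have "?t * (varx * U - ?\<delta> * (?\<delta> * Z')) * dx (fst (P, Q)) +
      ?t * (vary * U + varx * V + ?\<delta> * (?\<delta> * e')) * dy (fst (P, Q)) +
      ?t * (vary * V + ?\<delta> * (?\<delta> * Y')) * dy (snd (P, Q)) +
      (?t * - (?\<delta> * u)) * fst (P', Q') + (?t * - (?\<delta> * v)) * snd (P', Q') = 0"
    by (simp only: fst_conv snd_conv algebra_simps)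
  moreover have "homogeneous 3 (?t * (varx * U - ?\<delta> * (?\<delta> * Z')))"
    "homogeneous 3 (?t * (vary * U + varx * V + ?\<delta> * (?\<delta> * e')))"
    "homogeneous 3 (?t * (vary * V + ?\<delta> * (?\<delta> * Y')))"
    by (intro lift mult scale homogeneous_add homogeneous_diff UV hom')+
  moreover have "homogeneous 1 (?t * - (?\<delta> * u))" "homogeneous 1 (?t * - (?\<delta> * v))"
    by (intro lift1 scale homogeneous_uminus assms(2,3))+
  ultimately have "?t * - (?\<delta> * u) = 0" "?t * - (?\<delta> * v) = 0"
    using transversalD(4,5)[OF transversal] by blast+
  then show "u = 0" "v = 0"
    using of_nat_d_neq_0 by simp_all
qed

end

section \<open>The obstruction to being a gradient ideal\<close>

lemma hom_part_eq_0_nth: "hom_part k f = 0 \<Longrightarrow> i + j = k \<Longrightarrow> f $ j $ i = 0"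
  by (metis fps_zero_nth hom_part_nth)

lemma pair_in_ideal_gen:
  "u \<in> ideal_gen {u, v}" "v \<in> ideal_gen {u, v}" for u v :: "'a::comm_ring_1"
  by (rule module.span_base[OF module_mult], simp)+

text \<open>Otherwise \<open>x^3 P_x = 0\<close> would be a nontrivial relation between the
  columns.\<close>

lemma leading_part_neq_0:
  assumes "transversal d p q"
  shows "fst p \<noteq> 0"
proof
  assume "fst p = 0"
  then have "monomial 1 3 0 * dx (fst p) + 0 * dy (fst p) + 0 * dy (snd p) + 0 * fst q + 0 * snd q = 0"
    using dx_diff[of 0 0] by simp
  from transversalD(1)[OF assms homogeneous_monomial homogeneous_0 homogeneous_0 homogeneous_0
      homogeneous_0 this]
  have "monomial 1 3 0 = 0"
    by simp
  then show False
    by (metis fps_zero_nth monomial_nth zero_neq_one)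
qed

text \<open>Each inclusion of ideals enters once: \<open>\<Phi>_x\<close> and
  \<open>\<Phi>_y\<close> lying in \<open>(A, B)\<close> gives the matrix \<open>X, Y, Z, W\<close>,
  and \<open>A\<close> lying in \<open>(\<Phi>_x, \<Phi>_y)\<close> gives
  \<open>X(0) \<noteq> 0\<close>.\<close>

lemma gradient_ideal_obstruction:
  fixes A B C D \<Phi> :: cps2
  assumes low: "\<And>k. k < d \<Longrightarrow> hom_part k A = 0 \<and> hom_part k B = 0"
    and "d > 0"
    and eq: "dy A - dx B = C * A + D * B"
    and trans: "transversal d (parts A B d) (parts A B (Suc d))"
    and ideals: "ideal_gen {dx \<Phi>, dy \<Phi>} = ideal_gen {A, B}"
  shows "C $ 0 $ 1 + D $ 1 $ 0 = 0"
proof -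
  obtain X Y Z W where XYZW: "dx \<Phi> = X * A + Y * B" "dy \<Phi> = Z * A + W * B"
    using pair_in_ideal_gen(1)[of "dx \<Phi>" "dy \<Phi>"] pair_in_ideal_gen(2)[of "dy \<Phi>" "dx \<Phi>"]
    unfolding ideals unfolding ideal_gen_pair by blast
  define a where "a = dy X - dx Z + X * C"
  define b where "b = dy Y - dx W + X * D"
  define e where "e = X - W"
  have "dy (X * A + Y * B) = dx (Z * A + W * B)"
    using dy_dx[of \<Phi>] unfolding XYZW .
  moreover have dyA: "dy A = dx B + C * A + D * B"
    using eq by (simp add: algebra_simps)
  ultimately have star: "a * A + b * B + e * dx B + Y * dy B - Z * dx A = 0"
    by (simp add: a_def b_def e_def algebra_simps)

  \<comment> \<open>Degrees are counted from \<open>n = d - 1\<close>, the degree of the derivatives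
    of the leading forms and so the lowest degree in the syzygy.\<close>
  obtain n where d: "d = Suc n"
    using \<open>d > 0\<close> gr0_implies_Suc by blast
  define P where "P = hom_part (Suc n) A"
  define Q where "Q = hom_part (Suc n) B"
  define P' where "P' = hom_part (Suc (Suc n)) A"
  define Q' where "Q' = hom_part (Suc (Suc n)) B"
  have low_n: "hom_part n A = 0" "hom_part n B = 0"
    using low d by auto
  have low_mult: "hom_part n (u * A) = 0" "hom_part n (u * B) = 0" for u
    unfolding hom_part_mult using low d by (auto intro!: sum.neutral)
  have lead_mult: "hom_part (Suc n) (u * A) = hom_part 0 u * P" "hom_part (Suc n) (u * B) = hom_part 0 u * Q"
    for u
    using hom_part_mult_shift[of "Suc n" A 0 u] hom_part_mult_shift[of "Suc n" B 0 u] low d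
    by (simp_all add: P_def Q_def)
  have "hom_part n (dy A - dx B) = 0"
    unfolding eq hom_part_add low_mult by simp
  then have closed: "dy P = dx Q"
    by (simp add: hom_part_diff hom_part_dx hom_part_dy P_def Q_def)
  have "hom_part (Suc n) (dy A - dx B) = hom_part 0 C * P + hom_part 0 D * Q"
    unfolding eq hom_part_add lead_mult by simp
  then have "dy P' - dx Q' = scalar (C $ 0 $ 0) * P + scalar (D $ 0 $ 0) * Q"
    by (simp add: hom_part_diff hom_part_dx hom_part_dy P'_def Q'_def hom_part_0_eq)
  then interpret leading_pair d P Q P' Q' "C $ 0 $ 0" "D $ 0 $ 0"
    using trans closed
    by unfold_locales (simp_all add: parts_def d P_def Q_def P'_def Q'_def homogeneous_hom_part)

  have shift: "hom_part (n + m) (u * A) = (\<Sum>i\<le>m. hom_part i u * hom_part (n + m - i) A)"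
    "hom_part (n + m) (u * B) = (\<Sum>i\<le>m. hom_part i u * hom_part (n + m - i) B)"
    "hom_part (n + m) (u * dx A) = (\<Sum>i\<le>m. hom_part i u * dx (hom_part (Suc (n + m - i)) A))"
    "hom_part (n + m) (u * dx B) = (\<Sum>i\<le>m. hom_part i u * dx (hom_part (Suc (n + m - i)) B))"
    "hom_part (n + m) (u * dy B) = (\<Sum>i\<le>m. hom_part i u * dy (hom_part (Suc (n + m - i)) B))"
    for m u
  proof -
    have "k < n \<Longrightarrow> hom_part k A = 0" "k < n \<Longrightarrow> hom_part k B = 0" "k < n \<Longrightarrow> hom_part k (dx A) = 0"
      "k < n \<Longrightarrow> hom_part k (dx B) = 0" "k < n \<Longrightarrow> hom_part k (dy B) = 0" for k
      using low[of k] low[of "Suc k"] d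
      by (simp_all add: hom_part_dx hom_part_dy cps2_eq_iff dx_nth dy_nth)
    note * = this
    show "hom_part (n + m) (u * A) = (\<Sum>i\<le>m. hom_part i u * hom_part (n + m - i) A)"
      by (rule hom_part_mult_shift) (rule *)
    show "hom_part (n + m) (u * B) = (\<Sum>i\<le>m. hom_part i u * hom_part (n + m - i) B)"
      by (rule hom_part_mult_shift) (rule *)
    show "hom_part (n + m) (u * dx A) = (\<Sum>i\<le>m. hom_part i u * dx (hom_part (Suc (n + m - i)) A))"
      unfolding hom_part_dx[symmetric] by (rule hom_part_mult_shift) (rule *)
    show "hom_part (n + m) (u * dx B) = (\<Sum>i\<le>m. hom_part i u * dx (hom_part (Suc (n + m - i)) B))"
      unfolding hom_part_dx[symmetric] by (rule hom_part_mult_shift) (rule *)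
    show "hom_part (n + m) (u * dy B) = (\<Sum>i\<le>m. hom_part i u * dy (hom_part (Suc (n + m - i)) B))"
      unfolding hom_part_dy[symmetric] by (rule hom_part_mult_shift) (rule *)
  qed
  have "hom_part (n + m) (a * A) + hom_part (n + m) (b * B) + hom_part (n + m) (e * dx B) +
      hom_part (n + m) (Y * dy B) - hom_part (n + m) (Z * dx A) = 0" for m
    using arg_cong[OF star, of "hom_part (n + m)"]
    by (simp add: hom_part_add hom_part_diff hom_part_0)
  note star_m = this[unfolded shift]
  note parts_simps = P_def[symmetric] Q_def[symmetric] P'_def[symmetric] Q'_def[symmetric]
  note hom_parts = homogeneous_hom_part

  have E0: "hom_part 0 e * dx Q + hom_part 0 Y * dy Q - hom_part 0 Z * dx P = 0"
    using star_m[of 0] by (simp add: low_n parts_simps)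
  \<comment> \<open>In degree \<open>d - 1\<close> the coefficients are constants; the factor x
    makes them linear, so that \<open>syzygy_leading\<close> applies with \<open>m = 0\<close> and
    \<open>u = v = 0\<close>.\<close>
  have "0 * P + 0 * Q + (varx * hom_part 0 e) * dx Q + (varx * hom_part 0 Y) * dy Q -
      (varx * hom_part 0 Z) * dx P =
      varx * (hom_part 0 e * dx Q + hom_part 0 Y * dy Q - hom_part 0 Z * dx P)"
    by (simp add: algebra_simps)
  also have "\<dots> = 0"
    unfolding E0 by simp
  finally have E0': "0 * P + 0 * Q + (varx * hom_part 0 e) * dx Q + (varx * hom_part 0 Y) * dy Q -
      (varx * hom_part 0 Z) * dx P = 0" .
  have hom1: "homogeneous (Suc 0) (varx * hom_part 0 f)" for f
    using homogeneous_mult[OF homogeneous_varx homogeneous_hom_part[of 0 f]] by simp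
  have Z0: "hom_part 0 Z = 0" and Y0: "hom_part 0 Y = 0" and e0: "hom_part 0 e = 0"
    using syzygy_leading[OF _ homogeneous_0 homogeneous_0 hom1 hom1 hom1 E0'] of_nat_d_neq_0 by simp_all

  \<comment> \<open>First round, \<open>m = 0\<close>: degree \<open>d\<close> expresses the linear
    parts of \<open>e, Y, Z\<close> by the constant terms of \<open>a, b\<close>, and degree
    \<open>d + 1\<close> makes these vanish.\<close>
  have E1: "hom_part 0 a * P + hom_part 0 b * Q + hom_part (Suc 0) e * dx Q + hom_part (Suc 0) Y * dy Q -
      hom_part (Suc 0) Z * dx P = 0"
    using star_m[of "Suc 0"] by (simp add: low_n parts_simps Z0 Y0 e0)
  note rel1 = syzygy_leading[OF _ hom_parts hom_parts hom_parts hom_parts hom_parts E1, simplified]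
  have E2: "hom_part 0 a * P' + hom_part 0 b * Q' + hom_part (Suc 0) e * dx Q' + hom_part (Suc 0) Y * dy Q' -
      hom_part (Suc 0) Z * dx P' + (hom_part (Suc 0) a * P + hom_part (Suc 0) b * Q +
      hom_part (Suc (Suc 0)) e * dx Q + hom_part (Suc (Suc 0)) Y * dy Q - hom_part (Suc (Suc 0)) Z * dx P) = 0"
    using star_m[of "Suc (Suc 0)"] by (simp add: low_n parts_simps Z0 Y0 e0 algebra_simps)
  have a0: "hom_part 0 a = 0" and b0: "hom_part 0 b = 0"
    using syzygy_next[OF _ hom_parts hom_parts _ _ _ hom_parts hom_parts hom_parts hom_parts hom_parts E2]
      rel1 by simp_all
  have Z1: "hom_part (Suc 0) Z = 0" and Y1: "hom_part (Suc 0) Y = 0" and e1: "hom_part (Suc 0) e = 0"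
    using rel1 of_nat_d_neq_0 by (simp_all add: a0 b0)

  \<comment> \<open>Second round, \<open>m = 1\<close>, in degrees \<open>d + 1\<close> and
    \<open>d + 2\<close>.\<close>
  have E2': "hom_part (Suc 0) a * P + hom_part (Suc 0) b * Q +
      hom_part (Suc (Suc 0)) e * dx Q + hom_part (Suc (Suc 0)) Y * dy Q - hom_part (Suc (Suc 0)) Z * dx P = 0"
    using E2 by (simp add: Z1 Y1 e1 a0 b0)
  note rel2 = syzygy_leading[OF _ hom_parts hom_parts hom_parts hom_parts hom_parts E2', simplified]
  have E3: "hom_part (Suc 0) a * P' + hom_part (Suc 0) b * Q' +
      hom_part (Suc (Suc 0)) e * dx Q' + hom_part (Suc (Suc 0)) Y * dy Q' - hom_part (Suc (Suc 0)) Z * dx P' +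
      (hom_part (Suc (Suc 0)) a * P + hom_part (Suc (Suc 0)) b * Q + hom_part (Suc (Suc (Suc 0))) e * dx Q +
      hom_part (Suc (Suc (Suc 0))) Y * dy Q - hom_part (Suc (Suc (Suc 0))) Z * dx P) = 0"
    using star_m[of "Suc (Suc (Suc 0))"]
    by (simp add: low_n parts_simps Z0 Y0 e0 Z1 Y1 e1 a0 b0 algebra_simps)
  have a1: "hom_part (Suc 0) a = 0" and b1: "hom_part (Suc 0) b = 0"
    using syzygy_next[OF _ hom_parts hom_parts _ _ _ hom_parts hom_parts hom_parts hom_parts hom_parts E3]
      rel2 by simp_all
  have Z2: "hom_part (Suc (Suc 0)) Z = 0" and Y2: "hom_part (Suc (Suc 0)) Y = 0"
    and e2: "hom_part (Suc (Suc 0)) e = 0"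
    using rel2 of_nat_d_neq_0 by (simp_all add: a1 b1)

  \<comment> \<open>If \<open>X(0) = 0\<close>, then \<open>W(0) = X(0)\<close> and
    \<open>Y(0) = Z(0) = 0\<close> make the whole matrix vanish at the origin. Then
    \<open>A\<close>, a combination of \<open>\<Phi>_x\<close> and \<open>\<Phi>_y\<close>, has no
    part of degree \<open>d\<close>, against \<open>P \<noteq> 0\<close>.\<close>
  have X0_neq: "X $ 0 $ 0 \<noteq> 0"
  proof
    assume X0: "X $ 0 $ 0 = 0"
    obtain r s where "A = r * dx \<Phi> + s * dy \<Phi>"
      using pair_in_ideal_gen(1)[of A B] unfolding ideals[symmetric] unfolding ideal_gen_pair by blast
    then have "A = (r * X + s * Z) * A + (r * Y + s * W) * B"
      by (simp add: XYZW algebra_simps)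
    then have "P = hom_part 0 (r * X + s * Z) * P + hom_part 0 (r * Y + s * W) * Q"
      unfolding P_def Q_def by (metis P_def Q_def hom_part_add lead_mult)
    moreover have "X $ 0 $ 0 = W $ 0 $ 0" "Y $ 0 $ 0 = 0" "Z $ 0 $ 0 = 0"
      using hom_part_eq_0_nth[OF e0, of 0 0] hom_part_eq_0_nth[OF Y0, of 0 0]
        hom_part_eq_0_nth[OF Z0, of 0 0] by (simp_all add: e_def)
    ultimately have "P = 0"
      using X0 by (simp add: hom_part_0_eq)
    with leading_part_neq_0[OF transversal] show False
      by simp
  qed

  have "a $ 0 $ 0 = 0" "b $ 0 $ 0 = 0" "a $ 0 $ 1 = 0" "b $ 1 $ 0 = 0"
    "Z $ 0 $ 1 = 0" "Y $ 1 $ 0 = 0" "e $ 0 $ 1 = 0"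
    "Z $ 0 $ 2 = 0" "Y $ 2 $ 0 = 0" "e $ 1 $ 1 = 0"
    using hom_part_eq_0_nth[OF a0, of 0 0] hom_part_eq_0_nth[OF b0, of 0 0]
      hom_part_eq_0_nth[OF a1, of 1 0] hom_part_eq_0_nth[OF b1, of 0 1]
      hom_part_eq_0_nth[OF Z1, of 1 0] hom_part_eq_0_nth[OF Y1, of 0 1]
      hom_part_eq_0_nth[OF e1, of 1 0]
      hom_part_eq_0_nth[OF Z2, of 2 0] hom_part_eq_0_nth[OF Y2, of 0 2] hom_part_eq_0_nth[OF e2, of 1 1]
    by simp_all
  \<comment> \<open>These are \<open>X_y = - X C\<close> and \<open>X_x = X D\<close> at the origin,
    then the x-coefficient of the first and the y-coefficient of the second, both involving
    \<open>X $ 1 $ 1\<close>. The vanishing of \<open>e\<close> has replaced \<open>W\<close> by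
    \<open>X\<close>.\<close>
  then have "X $ 1 $ 0 + X $ 0 $ 0 * C $ 0 $ 0 = 0" "X $ 0 $ 1 = X $ 0 $ 0 * D $ 0 $ 0"
    "X $ 1 $ 1 + (X $ 0 $ 0 * C $ 0 $ 1 + X $ 0 $ 1 * C $ 0 $ 0) = 0"
    "X $ 0 $ 0 * D $ 1 $ 0 + X $ 1 $ 0 * D $ 0 $ 0 = X $ 1 $ 1"
    by (simp_all add: a_def b_def e_def dx_nth dy_nth cps2_mult_nth numeral_2_eq_2)
  \<comment> \<open>Comparing the two expressions for the mixed coefficient \<open>x11\<close>, the
    products \<open>x * c00 * d00\<close> cancel.\<close>
  moreover have "x * (c01 + d10) = 0"
    if "x10 + x * c00 = 0" "x01 = x * d00" "x11 + (x * c01 + x01 * c00) = 0" "x * d10 + x10 * d00 = x11"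
    for x x10 x01 x11 c00 c01 d00 d10 :: complex
  proof -
    have "x10 = - (x * c00)"
      using that(1) by (simp add: add_eq_0_iff)
    then have "x * d10 - x * c00 * d00 = x11"
      using that(4) by simp
    then have "x * d10 - x * c00 * d00 + (x * c01 + x * d00 * c00) = 0"
      using that(2,3) by simp
    then show ?thesis
      by (simp add: algebra_simps)
  qed
  ultimately have "X $ 0 $ 0 * (C $ 0 $ 1 + D $ 1 $ 0) = 0"
    by blast
  with X0_neq show ?thesis
    by simp
qed

section \<open>Genericity of the solutions\<close>

text \<open>By Euler's identity this normalisation gives the form of degree \<open>d + 1\<close>
  with gradient \<open>p\<close> when \<open>p\<close> is a closed pair of forms of degree
  \<open>d\<close>.\<close>

definition potential :: "nat \<Rightarrow> cps2 \<times> cps2 \<Rightarrow> cps2" where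
  "potential d p = scalar (1 / of_nat (Suc d)) * (varx * fst p + vary * snd p)"

lemma of_nat_mult_scalar_inverse:
  assumes "n > 0"
  shows "of_nat n * scalar (1 / of_nat n) = 1"
  using assms unfolding of_nat_eq_scalar by simp

lemma homogeneous_potential:
  assumes "homogeneous d P" "homogeneous d Q"
  shows "homogeneous (Suc d) (potential d (P, Q))"
proof -
  have "homogeneous (Suc d) (varx * P + vary * Q)"
    using homogeneous_mult[OF homogeneous_varx assms(1)] homogeneous_mult[OF homogeneous_vary assms(2)]
    by (intro homogeneous_add) simp_all
  then show ?thesis
    using homogeneous_mult[OF homogeneous_scalar] unfolding potential_def by fastforce
qed

text \<open>Closedness turns \<open>P + x P_x + y Q_x\<close> into \<open>P + x P_x + y P_y\<close>,
  which is \<open>(d + 1) P\<close>; likewise for \<open>Q\<close>.\<close>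

lemma gradient_potential:
  assumes "homogeneous d P" "homogeneous d Q" "dy P = dx Q"
  shows "dx (potential d (P, Q)) = P" "dy (potential d (P, Q)) = Q"
proof -
  have inv: "scalar (1 / of_nat (Suc d)) * (of_nat (Suc d) * f) = f" for f :: cps2
    using of_nat_mult_scalar_inverse[of "Suc d"] by (metis mult.assoc mult.commute mult_1 zero_less_Suc)
  have "dx (potential d (P, Q)) = scalar (1 / of_nat (Suc d)) * (P + (varx * dx P + vary * dy P))"
    unfolding potential_def fst_conv snd_conv dx_mult dx_add dx_scalar dx_varx dx_vary assms(3)
    by (simp only: mult_zero_left mult_1_left add_0_left add_ac)
  also have "\<dots> = scalar (1 / of_nat (Suc d)) * (of_nat (Suc d) * P)"
    unfolding euler[OF assms(1)] by (simp add: algebra_simps)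
  finally show "dx (potential d (P, Q)) = P"
    unfolding inv .
  have "dy (potential d (P, Q)) = scalar (1 / of_nat (Suc d)) * (Q + (varx * dx Q + vary * dy Q))"
    unfolding potential_def fst_conv snd_conv dy_mult dy_add dy_scalar dy_varx dy_vary assms(3)
    by (simp only: mult_zero_left mult_1_left add_0_left add_ac)
  also have "\<dots> = scalar (1 / of_nat (Suc d)) * (of_nat (Suc d) * Q)"
    unfolding euler[OF assms(2)] by (simp add: algebra_simps)
  finally show "dy (potential d (P, Q)) = Q"
    unfolding inv .
qed

text \<open>By Euler's identity a form lies in the ideal of its second derivatives.\<close>

lemma transversal_add_potential:
  assumes trans: "transversal d (P, Q) (P', Q')" and "d > 0"
    and hom: "homogeneous d P" "homogeneous d Q" and closed: "dy P = dx Q"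
  shows "transversal d (P, Q)
    (scalar s * potential d (P, Q) + P', scalar t * potential d (P, Q) + Q')"
proof (rule transversalI)
  fix \<alpha> \<beta> \<gamma> a b
  assume homs: "homogeneous 3 \<alpha>" "homogeneous 3 \<beta>" "homogeneous 3 \<gamma>" "homogeneous 1 a" "homogeneous 1 b"
    and vanish: "\<forall>(i, j) \<in> set (positions d). (\<alpha> * dx (fst (P, Q)) + \<beta> * dy (fst (P, Q)) +
      \<gamma> * dy (snd (P, Q)) + a * fst (scalar s * potential d (P, Q) + P', scalar t * potential d (P, Q) + Q') +
      b * snd (scalar s * potential d (P, Q) + P', scalar t * potential d (P, Q) + Q')) $ j $ i = 0"
  \<comment> \<open>Euler's identity used twice writes the potential as
    \<open>(x^2 P_x + 2 x y P_y + y^2 Q_y) / ((d + 1) d)\<close>. Hence the potential terms shift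
    the cubic coefficients by \<open>w\<close> times \<open>x^2\<close>, \<open>2 x y\<close> and
    \<open>y^2\<close>.\<close>
  define w where "w = scalar (1 / (of_nat (Suc d) * of_nat d)) * (scalar s * a + scalar t * b)"
  have inv: "scalar (1 / of_nat d) * (of_nat d * f) = f" for f :: cps2
    using of_nat_mult_scalar_inverse[of d] \<open>d > 0\<close> by (metis mult.assoc mult.commute mult_1)
  have P: "P = scalar (1 / of_nat d) * (varx * dx P + vary * dy P)"
    and Q: "Q = scalar (1 / of_nat d) * (varx * dy P + vary * dy Q)"
    using inv[of P] inv[of Q] euler[OF hom(1)] euler[OF hom(2)] closed by simp_all
  have "potential d (P, Q) = scalar (1 / of_nat (Suc d)) *
      (varx * (scalar (1 / of_nat d) * (varx * dx P + vary * dy P)) +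
       vary * (scalar (1 / of_nat d) * (varx * dy P + vary * dy Q)))"
    unfolding potential_def fst_conv snd_conv using P Q by simp
  also have "\<dots> = (scalar (1 / of_nat (Suc d)) * scalar (1 / of_nat d)) *
      ((varx * varx) * dx P + (varx * vary + varx * vary) * dy P + (vary * vary) * dy Q)"
    by (simp add: algebra_simps del: fps_const_mult)
  also have "scalar (1 / of_nat (Suc d)) * scalar (1 / of_nat d) = scalar (1 / (of_nat (Suc d) * of_nat d))"
    by simp
  finally have f: "potential d (P, Q) = scalar (1 / (of_nat (Suc d) * of_nat d)) *
      ((varx * varx) * dx P + (varx * vary + varx * vary) * dy P + (vary * vary) * dy Q)" .
  have w: "homogeneous 1 w"
    unfolding w_def
    using homogeneous_mult[OF homogeneous_scalar homogeneous_add[OF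
          homogeneous_mult[OF homogeneous_scalar homs(4)] homogeneous_mult[OF homogeneous_scalar homs(5)]]]
    by simp
  have quad: "homogeneous 3 (w * (m * m'))" if "homogeneous 1 m" "homogeneous 1 m'" for m m'
    using homogeneous_mult[OF w homogeneous_mult[OF that]] by (simp add: numeral_3_eq_3)
  have "\<alpha> * dx P + \<beta> * dy P + \<gamma> * dy Q + a * (scalar s * potential d (P, Q) + P') +
      b * (scalar t * potential d (P, Q) + Q') =
      \<alpha> * dx P + \<beta> * dy P + \<gamma> * dy Q + (scalar s * a + scalar t * b) * potential d (P, Q) + a * P' + b * Q'"
    by (simp add: algebra_simps)
  also have "(scalar s * a + scalar t * b) * potential d (P, Q) =
      w * ((varx * varx) * dx P + (varx * vary + varx * vary) * dy P + (vary * vary) * dy Q)"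
    unfolding f w_def by (simp only: mult_ac)
  finally have eq: "\<alpha> * dx P + \<beta> * dy P + \<gamma> * dy Q + a * (scalar s * potential d (P, Q) + P') +
      b * (scalar t * potential d (P, Q) + Q') =
      (\<alpha> + w * (varx * varx)) * dx P + (\<beta> + (w * (varx * vary) + w * (varx * vary))) * dy P +
      (\<gamma> + w * (vary * vary)) * dy Q + a * P' + b * Q'"
    by (simp only: algebra_simps)
  have "\<forall>(i, j) \<in> set (positions d). ((\<alpha> + w * (varx * varx)) * dx (fst (P, Q)) +
      (\<beta> + (w * (varx * vary) + w * (varx * vary))) * dy (fst (P, Q)) +
      (\<gamma> + w * (vary * vary)) * dy (snd (P, Q)) + a * fst (P', Q') + b * snd (P', Q')) $ j $ i = 0"
    using vanish unfolding fst_conv snd_conv eq .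
  from transversalD_positions[OF trans _ _ _ homs(4,5) this]
  have z: "\<alpha> + w * (varx * varx) = 0" "\<beta> + (w * (varx * vary) + w * (varx * vary)) = 0"
    "\<gamma> + w * (vary * vary) = 0" "a = 0" "b = 0"
    using homs quad[OF homogeneous_varx homogeneous_varx] quad[OF homogeneous_varx homogeneous_vary]
      quad[OF homogeneous_vary homogeneous_vary] by (blast intro: homogeneous_add)+
  \<comment> \<open>With \<open>a = b = 0\<close> also \<open>w = 0\<close>, so the shifted cubics
    are the original ones.\<close>
  then show "\<alpha> = 0 \<and> \<beta> = 0 \<and> \<gamma> = 0 \<and> a = 0 \<and> b = 0"
    by (simp add: w_def)
qed

section \<open>The solution spaces of the recursion\<close>

lemma homogeneous_antiderivative:
  assumes "homogeneous m f"
  obtains g where "homogeneous (Suc m) g" "dy g = f"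
proof
  define g :: cps2 where
    "g = Abs_fps (\<lambda>j. Abs_fps (\<lambda>i. if j = 0 then 0 else f $ (j - 1) $ i / of_nat j))"
  show "homogeneous (Suc m) g"
    using assms by (fastforce simp: homogeneous_def g_def split: if_splits)
  show "dy g = f"
    by (simp add: cps2_eq_iff dy_nth g_def del: of_nat_Suc)
qed

lemma solutions_restrict:
  "solutions C D d k (restrict h {d..<k}) = solutions C D d k h"
proof -
  have "restrict h {d..<k} (k - 1 - i) = h (k - 1 - i)" if "i < k - d" for i
    using that by auto
  then show ?thesis
    unfolding solutions_def by simp
qed

lemma solutions_first:
  "(P, Q) \<in> solutions C D d d h \<longleftrightarrow> homogeneous d P \<and> homogeneous d Q \<and> dy P = dx Q"
  by (simp add: solutions_def)

text \<open>Take \<open>Q = 0\<close> and integrate the right hand side in y. This makes the empty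
  set a proper subset at the stages where no condition is imposed.\<close>

lemma solutions_nonempty:
  assumes "d \<le> k" "\<And>j. j \<in> {d..<k} \<Longrightarrow> h j \<in> solutions C D d j h"
  shows "solutions C D d k h \<noteq> {}"
proof (cases "k = d")
  case True
  have "(0, 0) \<in> solutions C D d d h"
    using dx_diff[of 0 0] dy_diff[of 0 0] by (simp add: solutions_first homogeneous_0)
  with True show ?thesis
    by blast
next
  case False
  define f where "f = (\<Sum>i<k - d. hom_part i C * fst (h (k - 1 - i))) +
    (\<Sum>i<k - d. hom_part i D * snd (h (k - 1 - i)))"
  have "homogeneous (k - 1) (hom_part i C * fst (h (k - 1 - i)))"
    "homogeneous (k - 1) (hom_part i D * snd (h (k - 1 - i)))" if "i < k - d" for i
  proof -
    have "homogeneous (k - 1 - i) (fst (h (k - 1 - i)))" "homogeneous (k - 1 - i) (snd (h (k - 1 - i)))"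
      using assms(2)[of "k - 1 - i"] that unfolding solutions_def by (auto simp: case_prod_beta)
    from this[THEN homogeneous_mult[OF homogeneous_hom_part]]
    have "homogeneous (i + (k - 1 - i)) (hom_part i C * fst (h (k - 1 - i)))"
      "homogeneous (i + (k - 1 - i)) (hom_part i D * snd (h (k - 1 - i)))" .
    moreover have "i + (k - 1 - i) = k - 1"
      using that by simp
    ultimately show "homogeneous (k - 1) (hom_part i C * fst (h (k - 1 - i)))"
      "homogeneous (k - 1) (hom_part i D * snd (h (k - 1 - i)))"
      by simp_all
  qed
  then have "homogeneous (k - 1) f"
    unfolding f_def by (intro homogeneous_add homogeneous_sum) auto
  then obtain g where "homogeneous (Suc (k - 1)) g" "dy g = f"
    by (rule homogeneous_antiderivative)
  moreover have "Suc (k - 1) = k"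
    using False assms(1) by simp
  ultimately have "(g, 0) \<in> solutions C D d k h"
    using dx_diff[of 0 0] by (simp add: solutions_def f_def homogeneous_0)
  then show ?thesis
    by blast
qed

text \<open>With \<open>f\<close> the potential, the right hand side is
  \<open>C_0 f_x + D_0 f_y\<close>, so \<open>(D_0 f, - C_0 f)\<close> is a particular solution, and
  adding the gradient of \<open>g\<close> does not change the left hand side.\<close>

lemma solutions_Suc_potential:
  assumes "h d = (P, Q)" "homogeneous d P" "homogeneous d Q" "dy P = dx Q"
    and "homogeneous (Suc (Suc d)) g"
  shows "(scalar (D $ 0 $ 0) * potential d (P, Q) + dx g,
      scalar (- (C $ 0 $ 0)) * potential d (P, Q) + dy g) \<in> solutions C D d (Suc d) h"
proof -
  let ?f = "potential d (P, Q)"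
  have "homogeneous (Suc d) (scalar c * ?f)" for c
    using homogeneous_mult[OF homogeneous_scalar homogeneous_potential[OF assms(2,3)]] by simp
  moreover have "dy (scalar (D $ 0 $ 0) * ?f + dx g) - dx (scalar (- (C $ 0 $ 0)) * ?f + dy g) =
      scalar (C $ 0 $ 0) * P + scalar (D $ 0 $ 0) * Q"
  proof -
    have "scalar (- (C $ 0 $ 0)) = - scalar (C $ 0 $ 0)"
      by simp
    moreover have "dy (scalar (D $ 0 $ 0) * ?f + dx g) = scalar (D $ 0 $ 0) * Q + dy (dx g)"
      "dx (scalar (- (C $ 0 $ 0)) * ?f + dy g) = scalar (- (C $ 0 $ 0)) * P + dy (dx g)"
      using gradient_potential[OF assms(2-4)] by (simp_all add: dy_dx)
    ultimately show ?thesis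
      by (simp del: fps_const_neg)
  qed
  moreover have "Suc d - d = Suc 0"
    by simp
  ultimately show ?thesis
    using homogeneous_dx[OF assms(5)] homogeneous_dy[OF assms(5)] assms(1)
    by (simp add: solutions_def homogeneous_add hom_part_0_eq)
qed

section \<open>The exceptional subsets\<close>

lemma zariski_closed_in_zeros:
  assumes "polynomial_fun f"
  shows "zariski_closed_in S {p \<in> S. f p = 0}"
  unfolding zariski_closed_in_def using assms by (intro exI[of _ "{f}"]) auto

lemma zariski_closed_in_empty: "zariski_closed_in S {}"
  using zariski_closed_in_zeros[OF polynomial_fun.const[of 1], of S] by simp

lemma homogeneous_witness:
  assumes "d \<ge> 15"
  shows "homogeneous (Suc d) (witness_form d)" "homogeneous (Suc (Suc d)) (witness_next d)"
  unfolding witness_form_def witness_next_def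
  using assms by (auto intro!: homogeneous_add homogeneous_monomial)

text \<open>Transversality of the chosen pairs is a joint condition on two stages. Stage
  \<open>d\<close> secures that some second pair works, here the fixed \<open>w\<close>; stage
  \<open>d + 1\<close> then excludes the bad second pairs. For a history that already fails at stage
  \<open>d\<close> the set is empty, which keeps it proper for every history.\<close>

definition exceptional ::
  "cps2 \<Rightarrow> cps2 \<Rightarrow> nat \<Rightarrow> nat \<Rightarrow> (nat \<Rightarrow> cps2 \<times> cps2) \<Rightarrow> (cps2 \<times> cps2) set" where
  "exceptional C D d k h =
     (let w = (dx (witness_next d), dy (witness_next d)) in
      if k = d then {p \<in> solutions C D d k h. \<not> transversal d p w}
      else if k = Suc d \<and> transversal d (h d) w
        then {q \<in> solutions C D d k h. \<not> transversal d (h d) q}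
      else {})"

lemma exceptional_family_exceptional:
  assumes "d \<ge> 15"
  shows "exceptional_family C D d (exceptional C D d)"
  unfolding exceptional_family_def
proof (intro allI impI)
  fix k h assume "d \<le> k" and h: "\<forall>j\<in>{d..<k}. h j \<in> solutions C D d j h"
  let ?S = "solutions C D d k h" and ?Z = "exceptional C D d k (restrict h {d..<k})"
  let ?w = "(dx (witness_next d), dy (witness_next d))"
  consider (first) "k = d" | (second) "k = Suc d" "transversal d (h d) ?w" |
    (other) "k \<noteq> d" "k = Suc d \<Longrightarrow> \<not> transversal d (h d) ?w"
    by blast
  then show "zariski_closed_in ?S ?Z \<and> ?Z \<noteq> ?S"
  proof cases
    case first
    obtain F where F: "polynomial_fun F" "\<And>p. F p \<noteq> 0 \<longleftrightarrow> transversal d p ?w"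
      using transversal_polynomial_fst[of d ?w] by blast
    have Z: "?Z = {p \<in> ?S. F p = 0}"
      unfolding exceptional_def solutions_restrict using first F(2) by auto
    let ?p = "(dx (witness_form d), dy (witness_form d))"
    have "?p \<in> ?S"
      using homogeneous_witness(1)[OF assms] dy_dx
      by (simp add: first solutions_first homogeneous_dx homogeneous_dy)
    moreover have "F ?p \<noteq> 0"
      using transversal_witness[OF assms] F(2) by blast
    ultimately show ?thesis
      using zariski_closed_in_zeros[OF F(1)] unfolding Z by blast
  next
    case second
    obtain F where F: "polynomial_fun F" "\<And>q. F q \<noteq> 0 \<longleftrightarrow> transversal d (h d) q"
      using transversal_polynomial_snd[of d "h d"] by blast
    have Z: "?Z = {p \<in> ?S. F p = 0}"
      unfolding exceptional_def solutions_restrict using second F(2) by auto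
    obtain P Q where PQ: "h d = (P, Q)"
      by (cases "h d")
    have "(P, Q) \<in> solutions C D d d h"
      using h PQ second(1) by force
    then have *: "homogeneous d P" "homogeneous d Q" "dy P = dx Q"
      by (simp_all add: solutions_first)
    \<comment> \<open>The gradient \<open>w\<close> need not solve the equation of stage
      \<open>d + 1\<close>; correcting it by multiples of the potential gives a solution, and this
      preserves transversality.\<close>
    let ?q = "(scalar (D $ 0 $ 0) * potential d (P, Q) + dx (witness_next d),
      scalar (- (C $ 0 $ 0)) * potential d (P, Q) + dy (witness_next d))"
    have "?q \<in> ?S"
      using solutions_Suc_potential[where h = h and d = d, OF PQ * homogeneous_witness(2)[OF assms]] second(1) by simp
    moreover have "transversal d (h d) ?q"
      using transversal_add_potential[OF _ _ *] second(2) assms unfolding PQ by simp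
    then have "F ?q \<noteq> 0"
      using F(2) by blast
    ultimately show ?thesis
      using zariski_closed_in_zeros[OF F(1)] unfolding Z by blast
  next
    case other
    then have "?Z = {}"
      by (auto simp: exceptional_def)
    then show ?thesis
      using zariski_closed_in_empty solutions_nonempty[OF \<open>d \<le> k\<close>, of h C D] h by auto
  qed
qed

section \<open>From the recursion to power series\<close>

lemma almost_closed_if_parts_solve:
  assumes low: "\<And>k. k < d \<Longrightarrow> hom_part k A = 0 \<and> hom_part k B = 0"
    and sol: "\<And>k. k \<ge> d \<Longrightarrow> parts A B k \<in> solutions C D d k (parts A B)"
  shows "dy A - dx B = C * A + D * B"
proof (rule cps2_eqI_hom_part)
  fix k
  have trunc: "hom_part k (u * f) = (\<Sum>i<Suc k - d. hom_part i u * hom_part (k - i) f)"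
    if "\<And>k. k < d \<Longrightarrow> hom_part k f = 0" for u f
    unfolding hom_part_mult using that by (intro sum.mono_neutral_right) auto
  \<comment> \<open>The part of degree \<open>k\<close> is the equation of stage
    \<open>k + 1\<close>; for \<open>k + 1 < d\<close> the bound \<open>Suc k - d\<close> is
    truncated to 0 and both sides vanish.\<close>
  have "dy (hom_part (Suc k) A) - dx (hom_part (Suc k) B) =
      (\<Sum>i<Suc k - d. hom_part i C * hom_part (k - i) A) + (\<Sum>i<Suc k - d. hom_part i D * hom_part (k - i) B)"
  proof (cases "d \<le> Suc k")
    case True
    then show ?thesis
      using sol[OF True] by (simp add: solutions_def parts_def)
  next
    case False
    then show ?thesis
      using low[of "Suc k"] dx_diff[of 0 0] dy_diff[of 0 0] by simp
  qed
  then show "hom_part k (dy A - dx B) = hom_part k (C * A + D * B)"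
    using low by (simp add: hom_part_diff hom_part_add hom_part_dx hom_part_dy trunc)
qed

theorem theorem3:
  fixes C D :: cps2 and d :: nat
  assumes "dx (hom_part 1 C) + dy (hom_part 1 D) \<noteq> 0"
    and "d \<ge> 18"
  shows "\<exists>Z. exceptional_family C D d Z \<and>
           (\<forall>A B. chosen_outside C D d Z A B \<longrightarrow>
              \<not> (\<exists>\<Phi> :: cps2. ideal_gen {dx \<Phi>, dy \<Phi>} = ideal_gen {A, B}))"
proof (intro exI conjI allI impI notI)
  show "exceptional_family C D d (exceptional C D d)"
    using assms(2) by (intro exceptional_family_exceptional) simp
next
  fix A B
  assume "chosen_outside C D d (exceptional C D d) A B"
    and "\<exists>\<Phi> :: cps2. ideal_gen {dx \<Phi>, dy \<Phi>} = ideal_gen {A, B}"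
  then have low: "\<And>k. k < d \<Longrightarrow> hom_part k A = 0 \<and> hom_part k B = 0"
    and sol: "\<And>k. k \<ge> d \<Longrightarrow> parts A B k \<in> solutions C D d k (parts A B)"
    and out: "\<And>k. k \<ge> d \<Longrightarrow> parts A B k \<notin> exceptional C D d k (restrict (parts A B) {d..<k})"
    unfolding chosen_outside_def by blast+
  let ?w = "(dx (witness_next d), dy (witness_next d))"
  \<comment> \<open>Avoiding the set of stage \<open>d\<close> gives this, which selects the
    nontrivial branch of \<open>exceptional\<close> at stage \<open>d + 1\<close>.\<close>
  have "transversal d (parts A B d) ?w"
    using out[of d] sol[of d] unfolding exceptional_def solutions_restrict by simp
  then have trans: "transversal d (parts A B d) (parts A B (Suc d))"
    using out[of "Suc d"] sol[of "Suc d"] unfolding exceptional_def solutions_restrict by simp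
  obtain \<Phi> where "ideal_gen {dx \<Phi>, dy \<Phi>} = ideal_gen {A, B}"
    using \<open>\<exists>\<Phi>. _ \<Phi>\<close> by blast
  then have "C $ 0 $ 1 + D $ 1 $ 0 = 0"
    using gradient_ideal_obstruction[OF low _ almost_closed_if_parts_solve[OF low sol] trans] assms(2)
    by simp
  then have "dx (hom_part 1 C) + dy (hom_part 1 D) = 0"
    by (auto simp: cps2_eq_iff dx_nth dy_nth hom_part_nth)
  with assms(1) show False
    by simp
qed

end
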